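(* Let $\Delta:[0,\infty)\to[0,\infty)$ and $\theta:[0,\infty)\to(-\infty,0]$ be continuous functions, let $x\ge0$, and let $\hat X$ be a generalized squared Bessel process II, i.e. the unique nonnegative solution of $$\hat X_t=x+2\int_0^t\sqrt{\hat X_u}\,dB_u+\int_0^t\big(\Delta(u)+2\theta(u)\hat X_u\big)du .$$ Then, for $\lambda\ge0$ and $t\ge0$, $$\mathbb E e^{-\lambda\hat X_t}=e^{-x\phi(t,\lambda)-\psi(t,\lambda)},$$ where $$\phi(t,\lambda)=\frac{\lambda}{k(t)+2\lambda\int_0^tk(u)du},\qquad \psi(t,\lambda)=v\Big(t,\frac{\lambda}{k(t)+2\lambda\int_0^tk(u)du}\Big),$$ $$k(t)=e^{-2\int_0^t\theta(u)du},\qquad v(t,z)=z\int_0^t\frac{\Delta(u)k(u)}{1-2z\int_0^uk(s)ds}\,du .$$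
   Context: $B$ is a standard one-dimensional Brownian motion. *)

theory Defs
  imports "HOL-Probability.Probability"
begin

text \<open>
  Processes are indexed by \<^typ>\<open>real\<close>, but only times \<open>t \<ge> 0\<close> matter. A filtration on
  \<open>[0, \<infinity>)\<close> is extended to negative times by \<open>F 0\<close>, say. Neither completeness nor
  right-continuity of \<open>F\<close> is assumed.
\<close>

locale brownian_motion = prob_space M + filtration "space M" F
  for M :: "'a measure" and F :: "real \<Rightarrow> 'a measure" +
  fixes B :: "real \<Rightarrow> 'a \<Rightarrow> real"
  assumes subalg: "\<And>t. subalgebra M (F t)"
    and adapted: "\<And>t. 0 \<le> t \<Longrightarrow> B t \<in> borel_measurable (F t)"
    and start: "AE \<omega> in M. B 0 \<omega> = 0"
    and continuous_paths: "AE \<omega> in M. continuous_on {0..} (\<lambda>t. B t \<omega>)"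
    and normal_increments: "\<And>s t. 0 \<le> s \<Longrightarrow> s < t \<Longrightarrow>
      distributed M lborel (\<lambda>\<omega>. B t \<omega> - B s \<omega>) (normal_density 0 (sqrt (t - s)))"
    and indep_increments: "\<And>s t. 0 \<le> s \<Longrightarrow> s < t \<Longrightarrow>
      indep_set (sets (F s)) (sets (vimage_algebra (space M) (\<lambda>\<omega>. B t \<omega> - B s \<omega>) borel))"

definition progressively_measurable :: "(real \<Rightarrow> 'a measure) \<Rightarrow> (real \<Rightarrow> 'a \<Rightarrow> real) \<Rightarrow> bool" where
  "progressively_measurable F H \<longleftrightarrow>
    (\<forall>t\<ge>0. (\<lambda>(u, \<omega>). H u \<omega>) \<in> borel_measurable (restrict_space borel {0..t} \<Otimes>\<^sub>M F t))"

text \<open>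
  The data \<open>n\<close>, \<open>\<tau>\<close>, \<open>\<xi>\<close> encode the simple process that equals \<open>\<xi> i\<close> on \<open>(\<tau> i, \<tau> (i + 1)]\<close>
  for \<open>i < n\<close> and is zero elsewhere.
\<close>

definition simple_data ::
    "(real \<Rightarrow> 'a measure) \<Rightarrow> nat \<Rightarrow> (nat \<Rightarrow> real) \<Rightarrow> (nat \<Rightarrow> 'a \<Rightarrow> real) \<Rightarrow> bool" where
  "simple_data F n \<tau> \<xi> \<longleftrightarrow> 0 \<le> \<tau> 0 \<and> (\<forall>i<n. \<tau> i < \<tau> (Suc i)) \<and>
    (\<forall>i<n. \<xi> i \<in> borel_measurable (F (\<tau> i)) \<and> (\<exists>C. \<forall>\<omega>\<in>space (F (\<tau> i)). \<bar>\<xi> i \<omega>\<bar> \<le> C))"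

definition simple_process ::
    "nat \<Rightarrow> (nat \<Rightarrow> real) \<Rightarrow> (nat \<Rightarrow> 'a \<Rightarrow> real) \<Rightarrow> real \<Rightarrow> 'a \<Rightarrow> real" where
  "simple_process n \<tau> \<xi> u \<omega> = (\<Sum>i<n. \<xi> i \<omega> * indicator {\<tau> i<..\<tau> (Suc i)} u)"

definition simple_integral ::
    "(real \<Rightarrow> 'a \<Rightarrow> real) \<Rightarrow> nat \<Rightarrow> (nat \<Rightarrow> real) \<Rightarrow> (nat \<Rightarrow> 'a \<Rightarrow> real) \<Rightarrow> real \<Rightarrow> 'a \<Rightarrow> real" where
  "simple_integral B n \<tau> \<xi> t \<omega> = (\<Sum>i<n. \<xi> i \<omega> * (B (min t (\<tau> (Suc i))) \<omega> - B (min t (\<tau> i)) \<omega>))"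

definition vanishes_in_prob :: "'a measure \<Rightarrow> (nat \<Rightarrow> 'a \<Rightarrow> ennreal) \<Rightarrow> bool" where
  "vanishes_in_prob M Y \<longleftrightarrow>
    (\<forall>e>0::real. (\<lambda>m. measure M {\<omega> \<in> space M. ennreal e < Y m \<omega>}) \<longlonglongrightarrow> 0)"

text \<open>
  \<open>I\<close> is a continuous version of the Ito integral process of \<open>H\<close>. The integrand is
  progressively measurable with almost surely locally square-integrable paths, and the integral is
  the limit in probability of the integrals of simple processes that approximate \<open>H\<close> in
  \<open>L\<^sup>2([0, t])\<close> in probability. The limits determine each \<open>I t\<close> up to a null set, and path
  continuity then determines \<open>I\<close> up to indistinguishability. As \<open>F\<close> need not be complete,
  \<open>I t\<close> is only required to be measurable with respect to \<open>M\<close>; when \<open>F\<close> contains the null sets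
  of \<open>M\<close>, adaptedness follows.
\<close>

definition has_ito_integral ::
    "'a measure \<Rightarrow> (real \<Rightarrow> 'a measure) \<Rightarrow> (real \<Rightarrow> 'a \<Rightarrow> real) \<Rightarrow>
      (real \<Rightarrow> 'a \<Rightarrow> real) \<Rightarrow> (real \<Rightarrow> 'a \<Rightarrow> real) \<Rightarrow> bool" where
  "has_ito_integral M F B H I \<longleftrightarrow>
    progressively_measurable F H \<and>
    (AE \<omega> in M. \<forall>t\<ge>0. (\<integral>\<^sup>+u\<in>{0..t}. ennreal ((H u \<omega>)\<^sup>2) \<partial>lborel) < \<infinity>) \<and>
    (\<forall>t\<ge>0. I t \<in> borel_measurable M) \<and>
    (AE \<omega> in M. continuous_on {0..} (\<lambda>t. I t \<omega>)) \<and>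
    (\<exists>n \<tau> \<xi>. (\<forall>m. simple_data F (n m) (\<tau> m) (\<xi> m)) \<and>
      (\<forall>t\<ge>0.
        vanishes_in_prob M (\<lambda>m \<omega>.
          \<integral>\<^sup>+u\<in>{0..t}. ennreal ((simple_process (n m) (\<tau> m) (\<xi> m) u \<omega> - H u \<omega>)\<^sup>2) \<partial>lborel) \<and>
        vanishes_in_prob M (\<lambda>m \<omega>.
          ennreal \<bar>simple_integral B (n m) (\<tau> m) (\<xi> m) t \<omega> - I t \<omega>\<bar>)))"

text \<open>
  A nonnegative continuous solution on \<open>[0, \<infinity>)\<close> of
  \<open>dX = 2 \<surd>X dB + (\<Delta> + 2 \<theta> X) dt\<close>, \<open>X 0 = x\<close>.
\<close>

definition gen_squared_bessel_II ::
    "'a measure \<Rightarrow> (real \<Rightarrow> 'a measure) \<Rightarrow> (real \<Rightarrow> 'a \<Rightarrow> real) \<Rightarrow>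
      (real \<Rightarrow> real) \<Rightarrow> (real \<Rightarrow> real) \<Rightarrow> real \<Rightarrow> (real \<Rightarrow> 'a \<Rightarrow> real) \<Rightarrow> bool" where
  "gen_squared_bessel_II M F B \<Delta> \<theta> x X \<longleftrightarrow>
    (\<forall>t\<ge>0. X t \<in> borel_measurable (F t)) \<and>
    (AE \<omega> in M. continuous_on {0..} (\<lambda>t. X t \<omega>)) \<and>
    (AE \<omega> in M. \<forall>t\<ge>0. 0 \<le> X t \<omega>) \<and>
    (\<exists>I. has_ito_integral M F B (\<lambda>u \<omega>. sqrt (X u \<omega>)) I \<and>
      (AE \<omega> in M. \<forall>t\<ge>0.
        X t \<omega> = x + 2 * I t \<omega> + integral {0..t} (\<lambda>u. \<Delta> u + 2 * \<theta> u * X u \<omega>)))"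

definition bessel_k :: "(real \<Rightarrow> real) \<Rightarrow> real \<Rightarrow> real" where
  "bessel_k \<theta> t = exp (- 2 * integral {0..t} \<theta>)"

definition bessel_v :: "(real \<Rightarrow> real) \<Rightarrow> (real \<Rightarrow> real) \<Rightarrow> real \<Rightarrow> real \<Rightarrow> real" where
  "bessel_v \<Delta> \<theta> t z =
    z * integral {0..t} (\<lambda>u. \<Delta> u * bessel_k \<theta> u / (1 - 2 * z * integral {0..u} (bessel_k \<theta>)))"

definition bessel_phi :: "(real \<Rightarrow> real) \<Rightarrow> real \<Rightarrow> real \<Rightarrow> real" where
  "bessel_phi \<theta> t l = l / (bessel_k \<theta> t + 2 * l * integral {0..t} (bessel_k \<theta>))"

definition bessel_psi :: "(real \<Rightarrow> real) \<Rightarrow> (real \<Rightarrow> real) \<Rightarrow> real \<Rightarrow> real \<Rightarrow> real" where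
  "bessel_psi \<Delta> \<theta> t l =
    bessel_v \<Delta> \<theta> t (l / (bessel_k \<theta> t + 2 * l * integral {0..t} (bessel_k \<theta>)))"

end

theory Submission
  imports Defs
begin

text \<open>
  Let \<open>f u = z * k u / (1 - 2 * z * integral {0..u} k)\<close> with \<open>z = bessel_phi \<theta> t l\<close>, the solution of the
  Riccati equation \<open>f' = 2 * f\<^sup>2 - 2 * \<theta> * f\<close> with \<open>f t = l\<close>. Integration by parts turns
  \<open>exp (- f u * X u + integral {0..u} (f * \<Delta>))\<close> into a constant multiple of the stochastic exponential of
  \<open>- 2 * \<integral> f * \<surd>X dB\<close>, so the claim is that this exponential has constant expectation.

  For elementary integrands this is the Gaussian moment generating function. Fatou's lemma then bounds the
  expectation of every stochastic exponential by \<open>1\<close>, which yields exponential moments of \<open>X\<close> of small order,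
  and from these a Novikov condition on all sufficiently short time intervals. On each of them
  a truncation argument gives equality, and finitely many of them cover \<open>[0, t]\<close>.

  Step functions approximate \<open>f\<close>, so neither Ito's formula nor stopping times are needed.
\<close>

section \<open>Elementary integrals\<close>

text \<open>For nonnegative \<open>f\<close> and \<open>X\<close> the process
  \<open>exp (- f u * X u + integral {0..u} (f * \<Delta>))\<close> is bounded on
  \<open>[0, t]\<close>, and with stopping times a bounded local martingale is at once a martingale.
  Without them this is of no help: the bound holds for the limit, not for the elementary
  exponentials that approximate it, so Fatou's lemma yields one inequality only. Uniform
  integrability has to come from the brackets instead, which are four times the integral of
  \<open>f^2 * X\<close>; this is why a Novikov condition enters. It is imposed on short intervals
  because only small exponential moments of \<open>X\<close> are at hand. The Riccati equation says
  that the \<open>X\<close>-terms cancel: the drift of \<open>- f * X\<close> contributes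
  \<open>- f' - 2 * \<theta> * f\<close> per unit of \<open>X\<close>, and this must equal
  \<open>- 2 * f^2\<close>, minus half the bracket rate. For \<open>1 / f\<close> the equation is
  linear, \<open>(1 / f)' = 2 * \<theta> / f - 2\<close>, with integrating factor \<open>k\<close>;
  that is the origin of the explicit formula.\<close>

lemma nn_integral_exp_normal:
  assumes "0 < \<sigma>"
  shows "(\<integral>\<^sup>+y. ennreal (normal_density 0 \<sigma> y) * ennreal (exp (c * y - c\<^sup>2 * \<sigma>\<^sup>2 / 2)) \<partial>lborel) = 1"
proof -
  \<comment> \<open>Completing the square: tilting a centred Gaussian density by an exponential only
    moves its mean to \<open>c * \<sigma>^2\<close>.\<close>
  have "normal_density 0 \<sigma> y * exp (c * y - c\<^sup>2 * \<sigma>\<^sup>2 / 2) = normal_density (c * \<sigma>\<^sup>2) \<sigma> y" for y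
    using assms
    by (simp add: normal_density_def exp_add[symmetric] field_simps power2_eq_square)
  then have "(\<integral>\<^sup>+y. ennreal (normal_density 0 \<sigma> y) * ennreal (exp (c * y - c\<^sup>2 * \<sigma>\<^sup>2 / 2)) \<partial>lborel) =
      (\<integral>\<^sup>+y. ennreal (normal_density (c * \<sigma>\<^sup>2) \<sigma> y) \<partial>lborel)"
    by (simp add: ennreal_mult'[symmetric])
  also have "\<dots> = emeasure (density lborel (normal_density (c * \<sigma>\<^sup>2) \<sigma>)) UNIV"
    by (subst emeasure_density) auto
  also have "\<dots> = 1"
    using prob_space.emeasure_space_1[OF prob_space_normal_density[OF assms, of "c * \<sigma>\<^sup>2"]] by simp
  finally show ?thesis .
qed

context brownian_motion
begin

lemma measurable_subalg: "f \<in> measurable (F t) N \<Longrightarrow> f \<in> measurable M N"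
  using measurable_from_subalg[OF subalg] .

lemma measurable_mono:
  assumes "f \<in> measurable (F s) N" "s \<le> t"
  shows "f \<in> measurable (F t) N"
proof -
  have "subalgebra (F t) (F s)"
    unfolding subalgebra_def using sets_F_mono[OF assms(2)] space_F by auto
  from measurable_from_subalg[OF this assms(1)] show ?thesis .
qed

text \<open>The identity map from \<open>M\<close> to \<open>F s\<close> carries all information up
  to time \<open>s\<close> and is independent of the increment. The pair therefore has a product
  law, and Fubini freezes everything known at time \<open>s\<close> while the Gaussian variable is
  integrated out.\<close>

lemma increment_integral:
  assumes "0 \<le> s" "s < t" and [measurable]: "h \<in> borel_measurable (F s \<Otimes>\<^sub>M borel)"
  shows "(\<integral>\<^sup>+\<omega>. h (\<omega>, B t \<omega> - B s \<omega>) \<partial>M) =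
    (\<integral>\<^sup>+\<omega>. \<integral>\<^sup>+y. ennreal (normal_density 0 (sqrt (t - s)) y) * h (\<omega>, y) \<partial>lborel \<partial>M)"
proof -
  have id[measurable]: "(\<lambda>\<omega>. \<omega>) \<in> measurable M (F s)"
    by (rule measurable_subalg[where t = s]) simp
  have Bt[measurable]: "B t \<in> borel_measurable M" "B s \<in> borel_measurable M"
    using adapted assms measurable_subalg by (auto intro!: measurable_subalg[OF adapted])
  let ?D = "\<lambda>\<omega>. B t \<omega> - B s \<omega>"
  let ?N = "density lborel (\<lambda>x. ennreal (normal_density 0 (sqrt (t - s)) x))"
  interpret P: prob_space "distr M (F s) (\<lambda>\<omega>. \<omega>)"
    by (rule prob_space_distr) measurable
  have dD: "distr M borel ?D = ?N"
    using normal_increments[OF assms(1,2)] by (simp add: distributed_def cong: distr_cong)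
  have [simp]: "sets ?N = sets borel" by simp
  have N: "prob_space ?N" using assms(2) prob_space_normal_density[of "sqrt (t - s)" 0] by simp
  interpret N: prob_space ?N by (rule N)
  have "(\<integral>\<^sup>+\<omega>. h (\<omega>, ?D \<omega>) \<partial>M) = (\<integral>\<^sup>+p. h p \<partial>distr M (F s \<Otimes>\<^sub>M borel) (\<lambda>\<omega>. (\<omega>, ?D \<omega>)))"
    by (subst nn_integral_distr) auto
  also have "distr M (F s \<Otimes>\<^sub>M borel) (\<lambda>\<omega>. (\<omega>, ?D \<omega>)) = distr M (F s) (\<lambda>\<omega>. \<omega>) \<Otimes>\<^sub>M ?N"
  proof (rule pair_measure_eqI[symmetric])
    fix A C assume A: "A \<in> sets (distr M (F s) (\<lambda>\<omega>. \<omega>))" and C: "C \<in> sets ?N"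
    then have AC[measurable]: "A \<in> sets (F s)" "C \<in> sets borel" by auto
    have AM: "A \<in> sets M" "A \<subseteq> space M"
      using AC(1) subalg[of s] sets.sets_into_space[of A M] unfolding subalgebra_def by blast+
    have D[measurable]: "?D \<in> borel_measurable M" by measurable
    have "?D -` C \<inter> space M \<in> sets (vimage_algebra (space M) ?D borel)"
      by (rule in_vimage_algebra) simp
    then have "prob (A \<inter> (?D -` C \<inter> space M)) = prob A * prob (?D -` C \<inter> space M)"
      using indep_increments[OF assms(1,2)] AC(1) unfolding indep_sets2_eq by blast
    moreover have "(\<lambda>\<omega>. (\<omega>, ?D \<omega>)) -` (A \<times> C) \<inter> space M = A \<inter> (?D -` C \<inter> space M)"
      using AM by auto
    moreover have "A \<times> C \<in> sets (F s \<Otimes>\<^sub>M borel)" by measurable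
    moreover have "emeasure ?N C = emeasure M (?D -` C \<inter> space M)"
      unfolding dD[symmetric] by (subst emeasure_distr) auto
    moreover have "emeasure (distr M (F s) (\<lambda>\<omega>. \<omega>)) A = emeasure M A"
      using AM by (subst emeasure_distr) (auto simp: Int_absorb2)
    ultimately show "emeasure (distr M (F s) (\<lambda>\<omega>. \<omega>)) A * emeasure ?N C =
        emeasure (distr M (F s \<Otimes>\<^sub>M borel) (\<lambda>\<omega>. (\<omega>, ?D \<omega>))) (A \<times> C)"
      by (simp add: emeasure_distr emeasure_eq_measure ennreal_mult')
  qed (auto intro: P.sigma_finite_measure_axioms N.sigma_finite_measure_axioms)
  also have "(\<integral>\<^sup>+p. h p \<partial>(distr M (F s) (\<lambda>\<omega>. \<omega>) \<Otimes>\<^sub>M ?N)) =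
      (\<integral>\<^sup>+\<omega>. \<integral>\<^sup>+y. h (\<omega>, y) \<partial>?N \<partial>distr M (F s) (\<lambda>\<omega>. \<omega>))"
    by (rule N.nn_integral_fst[symmetric]) (use assms(3) in \<open>simp cong: measurable_cong_sets\<close>)
  also have "\<dots> = (\<integral>\<^sup>+\<omega>. \<integral>\<^sup>+y. h (\<omega>, y) \<partial>?N \<partial>M)"
    by (subst nn_integral_distr) (auto intro!: N.borel_measurable_nn_integral)
  also have "\<dots> = (\<integral>\<^sup>+\<omega>. \<integral>\<^sup>+y. ennreal (normal_density 0 (sqrt (t - s)) y) * h (\<omega>, y) \<partial>lborel \<partial>M)"
    using space_F by (intro nn_integral_cong nn_integral_density) auto
  finally show ?thesis .
qed

text \<open>With \<open>\<xi>\<close> frozen, the inner integral is the normalised Gaussian moment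
  generating function and equals 1. The weight \<open>Y\<close> has values in
  \<open>ennreal\<close>, so that no integrability has to be carried through the inductions.\<close>

lemma exponential_increment:
  assumes "0 \<le> s" "s \<le> t" and [measurable]: "Y \<in> borel_measurable (F s)" "\<xi> \<in> borel_measurable (F s)"
  shows "(\<integral>\<^sup>+\<omega>. Y \<omega> * ennreal (exp (\<xi> \<omega> * (B t \<omega> - B s \<omega>) - (\<xi> \<omega>)\<^sup>2 * (t - s) / 2)) \<partial>M) =
    (\<integral>\<^sup>+\<omega>. Y \<omega> \<partial>M)"
proof (cases "s = t")
  case False
  then have st: "s < t" using assms by simp
  define h where "h = (\<lambda>(\<omega>, y). Y \<omega> * ennreal (exp (\<xi> \<omega> * y - (\<xi> \<omega>)\<^sup>2 * (t - s) / 2)))"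
  have h[measurable]: "h \<in> borel_measurable (F s \<Otimes>\<^sub>M borel)"
    unfolding h_def by measurable
  have "(\<integral>\<^sup>+\<omega>. h (\<omega>, B t \<omega> - B s \<omega>) \<partial>M) =
      (\<integral>\<^sup>+\<omega>. \<integral>\<^sup>+y. ennreal (normal_density 0 (sqrt (t - s)) y) * h (\<omega>, y) \<partial>lborel \<partial>M)"
    by (rule increment_integral[OF assms(1) st h])
  also have "\<dots> = (\<integral>\<^sup>+\<omega>. Y \<omega> \<partial>M)"
  proof (rule nn_integral_cong)
    fix \<omega>
    have "(\<integral>\<^sup>+y. ennreal (normal_density 0 (sqrt (t - s)) y) * h (\<omega>, y) \<partial>lborel) =
        (\<integral>\<^sup>+y. Y \<omega> * (ennreal (normal_density 0 (sqrt (t - s)) y) *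
          ennreal (exp (\<xi> \<omega> * y - (\<xi> \<omega>)\<^sup>2 * (sqrt (t - s))\<^sup>2 / 2))) \<partial>lborel)"
      using st by (simp add: h_def mult_ac)
    also have "\<dots> = Y \<omega>"
      using nn_integral_exp_normal[of "sqrt (t - s)" "\<xi> \<omega>"] st by (subst nn_integral_cmult) auto
    finally show "(\<integral>\<^sup>+y. ennreal (normal_density 0 (sqrt (t - s)) y) * h (\<omega>, y) \<partial>lborel) = Y \<omega>" .
  qed
  finally show ?thesis by (simp add: h_def)
qed simp

end

text \<open>\<open>L\<close> is the integral over \<open>(s, t]\<close> of a step process with
  deterministic nodes and \<open>A\<close> is its bracket. Building both one step at a time, instead
  of from arrays of nodes, turns concatenation, truncation and the martingale identity into rule
  inductions.\<close>

inductive elementary_integral ::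
    "(real \<Rightarrow> 'a measure) \<Rightarrow> (real \<Rightarrow> 'a \<Rightarrow> real) \<Rightarrow> real \<Rightarrow> real \<Rightarrow> ('a \<Rightarrow> real) \<Rightarrow> ('a \<Rightarrow> real) \<Rightarrow> bool"
  for F B s where
  start: "elementary_integral F B s s (\<lambda>_. 0) (\<lambda>_. 0)"
| append: "elementary_integral F B s t L A \<Longrightarrow> t \<le> u \<Longrightarrow> \<xi> \<in> borel_measurable (F t) \<Longrightarrow>
    elementary_integral F B s u (\<lambda>\<omega>. L \<omega> + \<xi> \<omega> * (B u \<omega> - B t \<omega>)) (\<lambda>\<omega>. A \<omega> + (\<xi> \<omega>)\<^sup>2 * (u - t))"

lemma elementary_integral_le: "elementary_integral F B s t L A \<Longrightarrow> s \<le> t"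
  by (induction rule: elementary_integral.induct) auto

lemma elementary_integral_extend:
  assumes "elementary_integral F B s t L A" "t \<le> u"
  shows "elementary_integral F B s u L A"
  using elementary_integral.append[OF assms, of "\<lambda>_. 0"] by simp

lemma elementary_integral_cmult:
  assumes "elementary_integral F B s t L A"
  shows "elementary_integral F B s t (\<lambda>\<omega>. c * L \<omega>) (\<lambda>\<omega>. c\<^sup>2 * A \<omega>)"
  using assms
proof (induction rule: elementary_integral.induct)
  case start
  then show ?case using elementary_integral.start by simp
next
  case (append t L A u \<xi>)
  from append(3) have [measurable]: "\<xi> \<in> borel_measurable (F t)" by simp
  have "(\<lambda>\<omega>. c * \<xi> \<omega>) \<in> borel_measurable (F t)" by measurable
  from elementary_integral.append[OF append.IH append(2) this]
  show ?case by (simp add: algebra_simps power_mult_distrib)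
qed

text \<open>The later integral is the first premise because the induction runs over it: its steps
  are appended to the earlier one.\<close>

lemma elementary_integral_trans:
  assumes "elementary_integral F B t u L' A'" and "elementary_integral F B s t L A"
  shows "elementary_integral F B s u (\<lambda>\<omega>. L \<omega> + L' \<omega>) (\<lambda>\<omega>. A \<omega> + A' \<omega>)"
  using assms
proof (induction rule: elementary_integral.induct)
  case start
  then show ?case by simp
next
  case (append t' L' A' u \<xi>)
  from elementary_integral.append[OF append.IH append(2,3)] append.prems
  show ?case by (simp add: algebra_simps)
qed

section \<open>Martingale identity and truncation for elementary integrals\<close>

context brownian_motion
begin

lemma elementary_integral_measurable:
  assumes "elementary_integral F B s t L A" "0 \<le> s"
  shows "L \<in> borel_measurable (F t)" "A \<in> borel_measurable (F t)"
proof -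
  from assms have "L \<in> borel_measurable (F t) \<and> A \<in> borel_measurable (F t)"
  proof (induction rule: elementary_integral.induct)
    case (append t L A u \<xi>)
    have "0 \<le> t" using elementary_integral_le append by fastforce
    have [measurable]: "L \<in> borel_measurable (F u)" "A \<in> borel_measurable (F u)"
      "\<xi> \<in> borel_measurable (F u)"
      using append measurable_mono by blast+
    have [measurable]: "B t \<in> borel_measurable (F u)" "B u \<in> borel_measurable (F u)"
      using adapted measurable_mono \<open>0 \<le> t\<close> append.hyps by (meson order_trans order_refl)+
    show ?case by auto
  qed auto
  then show "L \<in> borel_measurable (F t)" "A \<in> borel_measurable (F t)" by auto
qed

text \<open>The weight and the exponential of all steps but the last are known when the last step
  begins, so together they serve as the weight in \<open>exponential_increment\<close>. An arbitrary
  weight \<open>Y\<close> expresses the conditional expectation given \<open>F s\<close> without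
  introducing one.\<close>

lemma elementary_integral_exponential:
  assumes "elementary_integral F B s t L A" "0 \<le> s" "Y \<in> borel_measurable (F s)"
  shows "(\<integral>\<^sup>+\<omega>. Y \<omega> * ennreal (exp (L \<omega> - A \<omega> / 2)) \<partial>M) = (\<integral>\<^sup>+\<omega>. Y \<omega> \<partial>M)"
  using assms
proof (induction rule: elementary_integral.induct)
  case (append t L A u \<xi>)
  have st: "s \<le> t" using elementary_integral_le append by blast
  have [measurable]: "L \<in> borel_measurable (F t)" "A \<in> borel_measurable (F t)" "Y \<in> borel_measurable (F t)"
      "\<xi> \<in> borel_measurable (F t)"
    using append elementary_integral_measurable measurable_mono[OF _ st] by auto
  have "(\<integral>\<^sup>+\<omega>. Y \<omega> * ennreal (exp (L \<omega> + \<xi> \<omega> * (B u \<omega> - B t \<omega>) - (A \<omega> + (\<xi> \<omega>)\<^sup>2 * (u - t)) / 2)) \<partial>M) =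
     (\<integral>\<^sup>+\<omega>. (Y \<omega> * ennreal (exp (L \<omega> - A \<omega> / 2))) *
       ennreal (exp (\<xi> \<omega> * (B u \<omega> - B t \<omega>) - (\<xi> \<omega>)\<^sup>2 * (u - t) / 2)) \<partial>M)"
    by (simp add: mult.assoc ennreal_mult'[symmetric] exp_add[symmetric] add_divide_distrib diff_divide_distrib algebra_simps)
  also have "\<dots> = (\<integral>\<^sup>+\<omega>. Y \<omega> * ennreal (exp (L \<omega> - A \<omega> / 2)) \<partial>M)"
    using append st by (intro exponential_increment) auto
  finally show ?case using append by simp
qed simp

text \<open>A substitute for stopping at the time when the bracket reaches \<open>C\<close>.
  Brackets only grow, so wherever the final bracket is at most \<open>C\<close> no step has been
  switched off.\<close>

lemma elementary_integral_truncate: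
  assumes "elementary_integral F B s t L A" "0 \<le> s" "0 \<le> C"
  shows "\<exists>L' A'. elementary_integral F B s t L' A' \<and> (\<forall>\<omega>. A' \<omega> \<le> C) \<and>
    (\<forall>\<omega>. A \<omega> \<le> C \<longrightarrow> L' \<omega> = L \<omega> \<and> A' \<omega> = A \<omega>)"
  using assms
proof (induction rule: elementary_integral.induct)
  case start
  then show ?case
    by (intro exI[of _ "\<lambda>_. 0"]) (auto intro: elementary_integral.start)
next
  case (append t L A u \<xi>)
  then obtain L' A' where IH: "elementary_integral F B s t L' A'" "\<And>\<omega>. A' \<omega> \<le> C"
      "\<And>\<omega>. A \<omega> \<le> C \<Longrightarrow> L' \<omega> = L \<omega> \<and> A' \<omega> = A \<omega>"
    by blast
  have [measurable]: "A \<in> borel_measurable (F t)" "\<xi> \<in> borel_measurable (F t)"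
    using append elementary_integral_measurable by auto
  \<comment> \<open>The bracket after the step is already known at its left end \<open>t\<close>, so
    the decision to drop the step is \<open>F t\<close>-measurable.\<close>
  define \<zeta> where "\<zeta> \<omega> = (if A \<omega> + (\<xi> \<omega>)\<^sup>2 * (u - t) \<le> C then \<xi> \<omega> else 0)" for \<omega>
  have \<zeta>: "\<zeta> \<in> borel_measurable (F t)" unfolding \<zeta>_def by measurable
  have le: "A \<omega> \<le> C" if "A \<omega> + (\<xi> \<omega>)\<^sup>2 * (u - t) \<le> C" for \<omega>
    using that append(2) by (smt (verit) mult_nonneg_nonneg zero_le_power2)
  show ?case
    using elementary_integral.append[OF IH(1) append(2) \<zeta>] IH(2,3) le
    by (intro exI[of _ "\<lambda>\<omega>. L' \<omega> + \<zeta> \<omega> * (B u \<omega> - B t \<omega>)"]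
        exI[of _ "\<lambda>\<omega>. A' \<omega> + (\<zeta> \<omega>)\<^sup>2 * (u - t)"]) (auto simp: \<zeta>_def)
qed

end

section \<open>Limits of elementary integrals and their exponentials\<close>

lemma suminf_ennreal_tendsto_0:
  fixes f :: "nat \<Rightarrow> ennreal"
  assumes "(\<Sum>i. min (f i) 1) \<noteq> \<infinity>"
  shows "f \<longlonglongrightarrow> 0"
proof -
  define g where "g i = enn2real (min (f i) 1)" for i
  have g: "ennreal (g i) = min (f i) 1" for i
    unfolding g_def by (rule ennreal_enn2real) (simp add: min_less_iff_disj)
  have "summable g"
    by (rule summable_suminf_not_top) (use assms in \<open>simp add: g_def\<close>, use assms in \<open>simp add: g\<close>)
  then have "g \<longlonglongrightarrow> 0" by (rule summable_LIMSEQ_zero)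
  then have "(\<lambda>i. ennreal (g i)) \<longlonglongrightarrow> ennreal 0" by (rule tendsto_ennrealI)
  then have m: "(\<lambda>i. min (f i) 1) \<longlonglongrightarrow> 0" by (simp add: g)
  then have "\<forall>\<^sub>F i in sequentially. min (f i) 1 < 1" by (rule order_tendstoD) simp
  then have "\<forall>\<^sub>F i in sequentially. min (f i) 1 = f i"
    by eventually_elim (auto simp: min_def split: if_splits)
  with m show ?thesis by (simp cong: tendsto_cong)
qed

context prob_space
begin

text \<open>A Borel-Cantelli argument: the indices are chosen so that the capped expectations are
  summable. \<open>\<kappa>\<close> need not be increasing. The lemma serves both for diagonal
  sequences and, with \<open>e\<close> independent of \<open>N\<close>, for picking fast
  approximations.\<close>

lemma AE_tendsto_diagonal:
  fixes e :: "nat \<Rightarrow> nat \<Rightarrow> 'a \<Rightarrow> ennreal"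
  assumes [measurable]: "\<And>N k. e N k \<in> borel_measurable M"
    and lim: "\<And>N. (\<lambda>k. \<integral>\<^sup>+\<omega>. min (e N k \<omega>) 1 \<partial>M) \<longlonglongrightarrow> 0"
  shows "\<exists>\<kappa>. AE \<omega> in M. (\<lambda>N. e N (\<kappa> N) \<omega>) \<longlonglongrightarrow> 0"
proof -
  have "\<exists>k. (\<integral>\<^sup>+\<omega>. min (e N k \<omega>) 1 \<partial>M) < ennreal ((1/2)^N)" for N
    using order_tendstoD(2)[OF lim[of N], of "ennreal ((1/2)^N)"]
    by (auto simp: eventually_sequentially)
  then obtain \<kappa> where \<kappa>: "\<And>N. (\<integral>\<^sup>+\<omega>. min (e N (\<kappa> N) \<omega>) 1 \<partial>M) < ennreal ((1/2)^N)"
    by metis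
  have "(\<integral>\<^sup>+\<omega>. (\<Sum>N. min (e N (\<kappa> N) \<omega>) 1) \<partial>M) = (\<Sum>N. \<integral>\<^sup>+\<omega>. min (e N (\<kappa> N) \<omega>) 1 \<partial>M)"
    by (rule nn_integral_suminf) measurable
  also have "\<dots> \<le> (\<Sum>N. ennreal ((1/2)^N))"
    by (intro suminf_le less_imp_le \<kappa>) auto
  also have "\<dots> = ennreal (\<Sum>N. (1/2)^N)"
    by (rule suminf_ennreal2) (auto intro: summable_geometric)
  finally have "(\<integral>\<^sup>+\<omega>. (\<Sum>N. min (e N (\<kappa> N) \<omega>) 1) \<partial>M) \<noteq> \<infinity>"
    by (metis ennreal_neq_top infinity_ennreal_def top.extremum_unique)
  then have "AE \<omega> in M. (\<Sum>N. min (e N (\<kappa> N) \<omega>) 1) \<noteq> \<infinity>"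
    by (intro nn_integral_PInf_AE) measurable
  then have "AE \<omega> in M. (\<lambda>N. e N (\<kappa> N) \<omega>) \<longlonglongrightarrow> 0"
    by eventually_elim (rule suminf_ennreal_tendsto_0)
  then show ?thesis by blast
qed

lemma AE_tendsto_imp_nn_integral_min:
  fixes e :: "nat \<Rightarrow> 'a \<Rightarrow> ennreal"
  assumes [measurable]: "\<And>k. e k \<in> borel_measurable M" and "AE \<omega> in M. (\<lambda>k. e k \<omega>) \<longlonglongrightarrow> 0"
  shows "(\<lambda>k. \<integral>\<^sup>+\<omega>. min (e k \<omega>) 1 \<partial>M) \<longlonglongrightarrow> 0"
proof -
  have "(\<lambda>k. \<integral>\<^sup>+\<omega>. min (e k \<omega>) 1 \<partial>M) \<longlonglongrightarrow> (\<integral>\<^sup>+\<omega>. 0 \<partial>M)"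
  proof (rule nn_integral_dominated_convergence[where w = "\<lambda>_. 1"])
    show "AE \<omega> in M. (\<lambda>k. min (e k \<omega>) 1) \<longlonglongrightarrow> 0"
      using assms(2)
    proof eventually_elim
      case (elim \<omega>)
      from tendsto_min[OF this tendsto_const[of 1]] show ?case by simp
    qed
  qed (auto simp: emeasure_space_1)
  then show ?thesis by simp
qed

text \<open>The capped expectation is at most \<open>e\<close> plus the probability of exceeding
  \<open>e\<close>. This brings the convergence in \<open>has_ito_integral\<close> into the form
  that \<open>AE_tendsto_diagonal\<close> accepts.\<close>

lemma vanishes_in_prob_imp_nn_integral_min:
  assumes [measurable]: "\<And>k. Y k \<in> borel_measurable M" and "vanishes_in_prob M Y"
  shows "(\<lambda>k. \<integral>\<^sup>+\<omega>. min (Y k \<omega>) 1 \<partial>M) \<longlonglongrightarrow> 0"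
  unfolding order_tendsto_iff
proof (intro conjI allI impI)
  fix c :: ennreal assume "0 < c"
  then obtain d :: real where d: "0 < d" "ennreal d < c"
    by (metis dense ennreal_cases ennreal_less_zero_iff order_less_imp_not_less ennreal_top_neq_zero top.not_eq_extremum less_top ennreal_zero_less_top)
  define e where "e = d / 2"
  have e: "0 < e" using d by (simp add: e_def)
  have "(\<lambda>k. measure M {\<omega> \<in> space M. ennreal e < Y k \<omega>}) \<longlonglongrightarrow> 0"
    using assms(2) e by (auto simp: vanishes_in_prob_def)
  then have "\<forall>\<^sub>F k in sequentially. measure M {\<omega> \<in> space M. ennreal e < Y k \<omega>} < e"
    using e by (rule order_tendstoD)
  then show "\<forall>\<^sub>F k in sequentially. (\<integral>\<^sup>+\<omega>. min (Y k \<omega>) 1 \<partial>M) < c"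
  proof eventually_elim
    case (elim k)
    let ?S = "{\<omega> \<in> space M. ennreal e < Y k \<omega>}"
    have "(\<integral>\<^sup>+\<omega>. min (Y k \<omega>) 1 \<partial>M) \<le> (\<integral>\<^sup>+\<omega>. ennreal e + indicator ?S \<omega> \<partial>M)"
      by (intro nn_integral_mono) (auto simp: indicator_def min_le_iff_disj)
    also have "\<dots> = ennreal e + emeasure M ?S"
      by (subst nn_integral_add) (auto simp: emeasure_space_1)
    also have "\<dots> \<le> ennreal e + ennreal e"
      using elim by (intro add_mono) (auto simp: emeasure_eq_measure intro!: ennreal_leI)
    also have "\<dots> = ennreal d" using e by (simp add: ennreal_plus[symmetric] e_def del: ennreal_plus)
    finally show ?case using d by simp
  qed
qed auto

end

text \<open>The endpoints are fixed, so only two random variables are approximated and no path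
  regularity in time is involved. Convergence is almost sure, as Fatou's lemma and dominated
  convergence want it, and the brackets converge along with the integrals.\<close>

definition ito_limit ::
    "'a measure \<Rightarrow> (real \<Rightarrow> 'a measure) \<Rightarrow> (real \<Rightarrow> 'a \<Rightarrow> real) \<Rightarrow> real \<Rightarrow> real \<Rightarrow>
      ('a \<Rightarrow> real) \<Rightarrow> ('a \<Rightarrow> real) \<Rightarrow> bool" where
  "ito_limit M F B s t L A \<longleftrightarrow>
    (\<exists>Ls As. (\<forall>k::nat. elementary_integral F B s t (Ls k) (As k)) \<and>
      (AE \<omega> in M. (\<lambda>k. Ls k \<omega>) \<longlonglongrightarrow> L \<omega> \<and> (\<lambda>k. As k \<omega>) \<longlonglongrightarrow> A \<omega>))"

lemma ito_limit_start: "ito_limit M F B s s (\<lambda>_. 0) (\<lambda>_. 0)"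
  unfolding ito_limit_def using elementary_integral.start
  by (intro exI[of _ "\<lambda>_ _. 0"]) auto

lemma ito_limit_cmult:
  assumes "ito_limit M F B s t L A"
  shows "ito_limit M F B s t (\<lambda>\<omega>. c * L \<omega>) (\<lambda>\<omega>. c\<^sup>2 * A \<omega>)"
proof -
  from assms obtain Ls As where *: "\<And>k. elementary_integral F B s t (Ls k) (As k)"
    "AE \<omega> in M. (\<lambda>k. Ls k \<omega>) \<longlonglongrightarrow> L \<omega> \<and> (\<lambda>k. As k \<omega>) \<longlonglongrightarrow> A \<omega>"
    unfolding ito_limit_def by blast
  show ?thesis
    unfolding ito_limit_def
  proof (intro exI conjI allI)
    show "elementary_integral F B s t (\<lambda>\<omega>. c * Ls k \<omega>) (\<lambda>\<omega>. c\<^sup>2 * As k \<omega>)" for k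
      by (rule elementary_integral_cmult[OF *(1)])
    show "AE \<omega> in M. (\<lambda>k. c * Ls k \<omega>) \<longlonglongrightarrow> c * L \<omega> \<and> (\<lambda>k. c\<^sup>2 * As k \<omega>) \<longlonglongrightarrow> c\<^sup>2 * A \<omega>"
      using *(2) by eventually_elim (auto intro: tendsto_intros)
  qed
qed

lemma ito_limit_trans:
  assumes "ito_limit M F B s t L A" "ito_limit M F B t u L' A'"
  shows "ito_limit M F B s u (\<lambda>\<omega>. L \<omega> + L' \<omega>) (\<lambda>\<omega>. A \<omega> + A' \<omega>)"
proof -
  from assms(1) obtain Ls As where *: "\<And>k. elementary_integral F B s t (Ls k) (As k)"
    "AE \<omega> in M. (\<lambda>k. Ls k \<omega>) \<longlonglongrightarrow> L \<omega> \<and> (\<lambda>k. As k \<omega>) \<longlonglongrightarrow> A \<omega>"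
    unfolding ito_limit_def by blast
  from assms(2) obtain Ls' As' where **: "\<And>k. elementary_integral F B t u (Ls' k) (As' k)"
    "AE \<omega> in M. (\<lambda>k. Ls' k \<omega>) \<longlonglongrightarrow> L' \<omega> \<and> (\<lambda>k. As' k \<omega>) \<longlonglongrightarrow> A' \<omega>"
    unfolding ito_limit_def by blast
  show ?thesis
    unfolding ito_limit_def
  proof (intro exI conjI allI)
    show "elementary_integral F B s u (\<lambda>\<omega>. Ls k \<omega> + Ls' k \<omega>) (\<lambda>\<omega>. As k \<omega> + As' k \<omega>)" for k
      by (rule elementary_integral_trans[OF **(1) *(1)])
    show "AE \<omega> in M. (\<lambda>k. Ls k \<omega> + Ls' k \<omega>) \<longlonglongrightarrow> L \<omega> + L' \<omega> \<and>
        (\<lambda>k. As k \<omega> + As' k \<omega>) \<longlonglongrightarrow> A \<omega> + A' \<omega>"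
      using *(2) **(2) by eventually_elim (auto intro: tendsto_intros)
  qed
qed

lemma ito_limit_cong_AE:
  assumes "ito_limit M F B s t L A" "AE \<omega> in M. L \<omega> = L' \<omega> \<and> A \<omega> = A' \<omega>"
  shows "ito_limit M F B s t L' A'"
proof -
  from assms(1) obtain Ls As where *: "\<And>k. elementary_integral F B s t (Ls k) (As k)"
    "AE \<omega> in M. (\<lambda>k. Ls k \<omega>) \<longlonglongrightarrow> L \<omega> \<and> (\<lambda>k. As k \<omega>) \<longlonglongrightarrow> A \<omega>"
    unfolding ito_limit_def by blast
  from *(2) assms(2)
  have "AE \<omega> in M. (\<lambda>k. Ls k \<omega>) \<longlonglongrightarrow> L' \<omega> \<and> (\<lambda>k. As k \<omega>) \<longlonglongrightarrow> A' \<omega>"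
    by eventually_elim simp
  with *(1) show ?thesis unfolding ito_limit_def by blast
qed

context brownian_motion
begin

text \<open>The limits \<open>L\<close> and \<open>A\<close> need not be measurable; pointwise limits of the approximations are.\<close>

lemma ito_limit_obtain:
  assumes "ito_limit M F B s t L A" "0 \<le> s"
  obtains Ls As L0 A0 where "\<And>k. elementary_integral F B s t (Ls k) (As k)"
    "\<And>k. Ls k \<in> borel_measurable M" "\<And>k. As k \<in> borel_measurable M"
    "L0 \<in> borel_measurable M" "A0 \<in> borel_measurable M"
    "AE \<omega> in M. L \<omega> = L0 \<omega> \<and> A \<omega> = A0 \<omega>"
    "AE \<omega> in M. (\<lambda>k. Ls k \<omega>) \<longlonglongrightarrow> L0 \<omega> \<and> (\<lambda>k. As k \<omega>) \<longlonglongrightarrow> A0 \<omega>"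
proof -
  from assms obtain Ls As where *: "\<And>k. elementary_integral F B s t (Ls k) (As k)"
    "AE \<omega> in M. (\<lambda>k. Ls k \<omega>) \<longlonglongrightarrow> L \<omega> \<and> (\<lambda>k. As k \<omega>) \<longlonglongrightarrow> A \<omega>"
    unfolding ito_limit_def by blast
  have [measurable]: "Ls k \<in> borel_measurable M" "As k \<in> borel_measurable M" for k
    using elementary_integral_measurable[OF *(1) assms(2)] measurable_subalg by blast+
  show thesis
  proof (rule that[of Ls As "\<lambda>\<omega>. lim (\<lambda>k. Ls k \<omega>)" "\<lambda>\<omega>. lim (\<lambda>k. As k \<omega>)"])
    show "AE \<omega> in M. L \<omega> = lim (\<lambda>k. Ls k \<omega>) \<and> A \<omega> = lim (\<lambda>k. As k \<omega>)"
      using *(2) by eventually_elim (auto intro: limI[symmetric])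
    with *(2) show "AE \<omega> in M. (\<lambda>k. Ls k \<omega>) \<longlonglongrightarrow> lim (\<lambda>k. Ls k \<omega>) \<and>
        (\<lambda>k. As k \<omega>) \<longlonglongrightarrow> lim (\<lambda>k. As k \<omega>)"
      by eventually_elim auto
  qed (use *(1) in \<open>auto intro: borel_measurable_lim_metric\<close>)
qed

text \<open>An iterated almost sure limit is not by itself the almost sure limit of one sequence.
  The inner limits are therefore read as convergence of capped expectations, and one elementary
  integral is picked for each \<open>N\<close> by the diagonal lemma.\<close>

lemma ito_limit_closed:
  assumes "\<And>N::nat. ito_limit M F B s t (L N) (A N)" "0 \<le> s"
    and lim: "AE \<omega> in M. (\<lambda>N. L N \<omega>) \<longlonglongrightarrow> L' \<omega> \<and> (\<lambda>N. A N \<omega>) \<longlonglongrightarrow> A' \<omega>"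
  shows "ito_limit M F B s t L' A'"
proof -
  have "\<forall>N. \<exists>Ls As. (\<forall>k. elementary_integral F B s t (Ls k) (As k)) \<and>
      (AE \<omega> in M. (\<lambda>k. Ls k \<omega>) \<longlonglongrightarrow> L N \<omega> \<and> (\<lambda>k. As k \<omega>) \<longlonglongrightarrow> A N \<omega>)"
    using assms(1) unfolding ito_limit_def by blast
  from choice[OF this] obtain Ls where "\<forall>N. \<exists>As. (\<forall>k. elementary_integral F B s t (Ls N k) (As k)) \<and>
      (AE \<omega> in M. (\<lambda>k. Ls N k \<omega>) \<longlonglongrightarrow> L N \<omega> \<and> (\<lambda>k. As k \<omega>) \<longlonglongrightarrow> A N \<omega>)" ..
  from choice[OF this] obtain As where *: "\<And>N k. elementary_integral F B s t (Ls N k) (As N k)"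
      and conv: "\<And>N. AE \<omega> in M. (\<lambda>k. Ls N k \<omega>) \<longlonglongrightarrow> L N \<omega> \<and> (\<lambda>k. As N k \<omega>) \<longlonglongrightarrow> A N \<omega>"
    by blast
  have [measurable]: "Ls N k \<in> borel_measurable M" "As N k \<in> borel_measurable M" for N k
    using elementary_integral_measurable[OF * assms(2)] measurable_subalg by blast+
  \<comment> \<open>Measurable versions of \<open>L N\<close> and \<open>A N\<close>, so that the
    expected error makes sense.\<close>
  define L0 where "L0 N \<omega> = lim (\<lambda>k. Ls N k \<omega>)" for N \<omega>
  define A0 where "A0 N \<omega> = lim (\<lambda>k. As N k \<omega>)" for N \<omega>
  have [measurable]: "L0 N \<in> borel_measurable M" "A0 N \<in> borel_measurable M" for N
    unfolding L0_def A0_def by (auto intro: borel_measurable_lim_metric)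
  have eq: "AE \<omega> in M. L N \<omega> = L0 N \<omega> \<and> A N \<omega> = A0 N \<omega>" for N
    using conv[of N] by eventually_elim (auto simp: L0_def A0_def intro: limI[symmetric])
  define e where "e N k \<omega> = ennreal (\<bar>Ls N k \<omega> - L0 N \<omega>\<bar> + \<bar>As N k \<omega> - A0 N \<omega>\<bar>)" for N k \<omega>
  have [measurable]: "e N k \<in> borel_measurable M" for N k unfolding e_def by measurable
  have "(\<lambda>k. \<integral>\<^sup>+\<omega>. min (e N k \<omega>) 1 \<partial>M) \<longlonglongrightarrow> 0" for N
  proof (rule AE_tendsto_imp_nn_integral_min)
    show "AE \<omega> in M. (\<lambda>k. e N k \<omega>) \<longlonglongrightarrow> 0"
      using conv[of N] eq[of N]
    proof eventually_elim
      case (elim \<omega>)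
      then have "(\<lambda>k. \<bar>Ls N k \<omega> - L0 N \<omega>\<bar> + \<bar>As N k \<omega> - A0 N \<omega>\<bar>) \<longlonglongrightarrow>
          \<bar>L0 N \<omega> - L0 N \<omega>\<bar> + \<bar>A0 N \<omega> - A0 N \<omega>\<bar>"
        by (intro tendsto_intros) auto
      then show ?case unfolding e_def by (subst ennreal_0[symmetric], intro tendsto_ennrealI) simp
    qed
  qed measurable
  from AE_tendsto_diagonal[of e, OF _ this] obtain \<kappa> where
    \<kappa>: "AE \<omega> in M. (\<lambda>N. e N (\<kappa> N) \<omega>) \<longlonglongrightarrow> 0" by auto
  have "AE \<omega> in M. \<forall>N. L N \<omega> = L0 N \<omega> \<and> A N \<omega> = A0 N \<omega>"
    using eq by (simp add: AE_all_countable)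
  with \<kappa> lim have "AE \<omega> in M. (\<lambda>N. Ls N (\<kappa> N) \<omega>) \<longlonglongrightarrow> L' \<omega> \<and> (\<lambda>N. As N (\<kappa> N) \<omega>) \<longlonglongrightarrow> A' \<omega>"
  proof eventually_elim
    case (elim \<omega>)
    have "(\<lambda>N. enn2real (e N (\<kappa> N) \<omega>)) \<longlonglongrightarrow> 0"
      using elim(1) by (intro tendsto_enn2real) auto
    then have 0: "(\<lambda>N. \<bar>Ls N (\<kappa> N) \<omega> - L N \<omega>\<bar> + \<bar>As N (\<kappa> N) \<omega> - A N \<omega>\<bar>) \<longlonglongrightarrow> 0"
      using elim(3) by (simp add: e_def del: ennreal_plus)
    have "(\<lambda>N. Ls N (\<kappa> N) \<omega> - L N \<omega>) \<longlonglongrightarrow> 0" "(\<lambda>N. As N (\<kappa> N) \<omega> - A N \<omega>) \<longlonglongrightarrow> 0"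
      by (rule Lim_null_comparison[OF _ 0]; simp)+
    from tendsto_add[OF this(1) conjunct1[OF elim(2)]] tendsto_add[OF this(2) conjunct2[OF elim(2)]]
    show ?case by simp
  qed
  with * show ?thesis unfolding ito_limit_def by (intro exI conjI allI)
qed

text \<open>Fatou's lemma applied to \<open>elementary_integral_exponential\<close>. It precedes
  every moment bound, so the moment bounds for \<open>X\<close> can be derived from it.\<close>

lemma ito_limit_exponential_le:
  assumes "ito_limit M F B s t L A" "0 \<le> s" "y \<in> borel_measurable (F s)"
  shows "(\<integral>\<^sup>+\<omega>. ennreal (y \<omega> * exp (L \<omega> - A \<omega> / 2)) \<partial>M) \<le> (\<integral>\<^sup>+\<omega>. ennreal (y \<omega>) \<partial>M)"
proof -
  obtain Ls As L0 A0 where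
    *: "\<And>k. elementary_integral F B s t (Ls k) (As k)"
    and [measurable]: "\<And>k. Ls k \<in> borel_measurable M" "\<And>k. As k \<in> borel_measurable M"
    "L0 \<in> borel_measurable M" "A0 \<in> borel_measurable M"
    and eq: "AE \<omega> in M. L \<omega> = L0 \<omega> \<and> A \<omega> = A0 \<omega>"
    and lim: "AE \<omega> in M. (\<lambda>k. Ls k \<omega>) \<longlonglongrightarrow> L0 \<omega> \<and> (\<lambda>k. As k \<omega>) \<longlonglongrightarrow> A0 \<omega>"
    by (rule ito_limit_obtain[OF assms(1,2)]) (rule that)
  have [measurable]: "y \<in> borel_measurable M" using assms(3) measurable_subalg by blast
  have E: "(\<integral>\<^sup>+\<omega>. ennreal (y \<omega> * exp (Ls k \<omega> - As k \<omega> / 2)) \<partial>M) = (\<integral>\<^sup>+\<omega>. ennreal (y \<omega>) \<partial>M)" for k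
    using elementary_integral_exponential[OF *(1) assms(2), of "\<lambda>\<omega>. ennreal (y \<omega>)"] assms(3)
    by (simp add: ennreal_mult'')
  have "(\<integral>\<^sup>+\<omega>. ennreal (y \<omega> * exp (L \<omega> - A \<omega> / 2)) \<partial>M) \<le>
      (\<integral>\<^sup>+\<omega>. liminf (\<lambda>k. ennreal (y \<omega> * exp (Ls k \<omega> - As k \<omega> / 2))) \<partial>M)"
  proof (rule nn_integral_mono_AE)
    show "AE \<omega> in M. ennreal (y \<omega> * exp (L \<omega> - A \<omega> / 2)) \<le>
        liminf (\<lambda>k. ennreal (y \<omega> * exp (Ls k \<omega> - As k \<omega> / 2)))"
      using eq lim
    proof eventually_elim
      case (elim \<omega>)
      then have "(\<lambda>k. ennreal (y \<omega> * exp (Ls k \<omega> - As k \<omega> / 2))) \<longlonglongrightarrow>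
          ennreal (y \<omega> * exp (L \<omega> - A \<omega> / 2))"
        by (intro tendsto_intros) auto
      then show ?case using lim_imp_Liminf[OF trivial_limit_sequentially] by (metis order_refl)
    qed
  qed
  also have "\<dots> \<le> liminf (\<lambda>k. \<integral>\<^sup>+\<omega>. ennreal (y \<omega> * exp (Ls k \<omega> - As k \<omega> / 2)) \<partial>M)"
    by (rule nn_integral_liminf) measurable
  also have "\<dots> = (\<integral>\<^sup>+\<omega>. ennreal (y \<omega>) \<partial>M)"
    unfolding E by (simp add: Liminf_const)
  finally show ?thesis .
qed

text \<open>
  A quantitative Novikov criterion. Truncating the brackets at \<open>C\<close> bounds the second moments of the
  approximating exponentials by \<open>exp C\<close>, while \<open>P (A \<ge> C) \<le> exp (- 3 * C) * E (exp (3 * A))\<close>, so that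
  the truncation costs only \<open>O (exp (- C))\<close>.
\<close>

lemma ito_limit_exponential_eq:
  assumes "ito_limit M F B s t L A" "0 \<le> s" "y \<in> borel_measurable (F s)"
    and y: "\<And>\<omega>. 0 \<le> y \<omega>" "\<And>\<omega>. y \<omega> \<le> 1"
    and fin: "(\<integral>\<^sup>+\<omega>. ennreal (exp (3 * A \<omega>)) \<partial>M) < \<infinity>"
  shows "(\<integral>\<^sup>+\<omega>. ennreal (y \<omega> * exp (L \<omega> - A \<omega> / 2)) \<partial>M) = (\<integral>\<^sup>+\<omega>. ennreal (y \<omega>) \<partial>M)"
proof (rule antisym)
  obtain Ls As L0 A0 where
    *: "\<And>k. elementary_integral F B s t (Ls k) (As k)"
    and [measurable]: "\<And>k. Ls k \<in> borel_measurable M" "\<And>k. As k \<in> borel_measurable M"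
    "L0 \<in> borel_measurable M" "A0 \<in> borel_measurable M"
    and eq: "AE \<omega> in M. L \<omega> = L0 \<omega> \<and> A \<omega> = A0 \<omega>"
    and lim: "AE \<omega> in M. (\<lambda>k. Ls k \<omega>) \<longlonglongrightarrow> L0 \<omega> \<and> (\<lambda>k. As k \<omega>) \<longlonglongrightarrow> A0 \<omega>"
    by (rule ito_limit_obtain[OF assms(1,2)]) (rule that)
  have [measurable]: "y \<in> borel_measurable M" using assms(3) measurable_subalg by blast
  define K where "K = enn2real (\<integral>\<^sup>+\<omega>. ennreal (exp (3 * A \<omega>)) \<partial>M)"
  have K: "(\<integral>\<^sup>+\<omega>. ennreal (exp (3 * A0 \<omega>)) \<partial>M) = ennreal K"
  proof -
    have "(\<integral>\<^sup>+\<omega>. ennreal (exp (3 * A0 \<omega>)) \<partial>M) = (\<integral>\<^sup>+\<omega>. ennreal (exp (3 * A \<omega>)) \<partial>M)"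
      by (rule nn_integral_cong_AE) (use eq in eventually_elim, simp)
    then show ?thesis unfolding K_def using fin by simp
  qed
  have K0: "0 \<le> K" by (simp add: K_def)
  let ?R = "\<integral>\<^sup>+\<omega>. ennreal (y \<omega> * exp (L \<omega> - A \<omega> / 2)) \<partial>M"
  have R: "?R = (\<integral>\<^sup>+\<omega>. ennreal (y \<omega> * exp (L0 \<omega> - A0 \<omega> / 2)) \<partial>M)"
    by (rule nn_integral_cong_AE) (use eq in eventually_elim, simp)
  have bound: "(\<integral>\<^sup>+\<omega>. ennreal (y \<omega>) \<partial>M) \<le> ?R + ennreal ((3/2 + K/2) * exp (- C))" if C: "0 \<le> C" for C
  proof -
    have "\<forall>k. \<exists>L' A'. elementary_integral F B s t L' A' \<and> (\<forall>\<omega>. A' \<omega> \<le> C) \<and>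
        (\<forall>\<omega>. As k \<omega> \<le> C \<longrightarrow> L' \<omega> = Ls k \<omega> \<and> A' \<omega> = As k \<omega>)"
      using elementary_integral_truncate[OF *(1) assms(2) C] by blast
    then obtain Lt At where t: "\<And>k. elementary_integral F B s t (Lt k) (At k)" "\<And>k \<omega>. At k \<omega> \<le> C"
        "\<And>k \<omega>. As k \<omega> \<le> C \<Longrightarrow> Lt k \<omega> = Ls k \<omega> \<and> At k \<omega> = As k \<omega>"
      by metis
    have [measurable]: "Lt k \<in> borel_measurable M" "At k \<in> borel_measurable M" for k
      using elementary_integral_measurable[OF t(1) assms(2)] measurable_subalg by blast+
    define D where "D k \<omega> = exp (Lt k \<omega> - At k \<omega> / 2)" for k \<omega>
    have [measurable]: "D k \<in> borel_measurable M" for k unfolding D_def by measurable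
    have D0: "0 < D k \<omega>" for k \<omega> by (simp add: D_def)
    have ED: "(\<integral>\<^sup>+\<omega>. ennreal (y \<omega> * D k \<omega>) \<partial>M) = (\<integral>\<^sup>+\<omega>. ennreal (y \<omega>) \<partial>M)" for k
      using elementary_integral_exponential[OF t(1) assms(2), of "\<lambda>\<omega>. ennreal (y \<omega>)"] assms(3)
      by (simp add: ennreal_mult'' D_def)
    \<comment> \<open>\<open>D^2\<close> is \<open>exp (At)\<close> times the exponential of the
      doubled integral, whose bracket is \<open>4 * At\<close>. The latter has expectation 1 and the
      former is at most \<open>exp C\<close>.\<close>
    have D2: "(\<integral>\<^sup>+\<omega>. ennreal ((D k \<omega>)\<^sup>2) \<partial>M) \<le> ennreal (exp C)" for k
    proof -
      have "(\<integral>\<^sup>+\<omega>. ennreal ((D k \<omega>)\<^sup>2) \<partial>M) \<le>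
          (\<integral>\<^sup>+\<omega>. ennreal (exp C) * ennreal (exp (2 * Lt k \<omega> - 2\<^sup>2 * At k \<omega> / 2)) \<partial>M)"
      proof (rule nn_integral_mono)
        fix \<omega>
        have "(D k \<omega>)\<^sup>2 = exp (2 * Lt k \<omega> - At k \<omega>)"
          by (simp add: D_def power2_eq_square exp_add[symmetric])
        also have "\<dots> \<le> exp (C + (2 * Lt k \<omega> - 2\<^sup>2 * At k \<omega> / 2))"
          using t(2)[of k \<omega>] by simp
        finally show "ennreal ((D k \<omega>)\<^sup>2) \<le>
            ennreal (exp C) * ennreal (exp (2 * Lt k \<omega> - 2\<^sup>2 * At k \<omega> / 2))"
          by (simp only: ennreal_mult'[symmetric] exp_ge_zero exp_add ennreal_leI)
      qed
      also have "\<dots> = ennreal (exp C)"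
        using elementary_integral_exponential[OF elementary_integral_cmult[OF t(1), of 2] assms(2), of "\<lambda>_. 1"]
        by (subst nn_integral_cmult) (auto simp: emeasure_space_1)
      finally show ?thesis .
    qed
    \<comment> \<open>The cap supplies the constant for dominated convergence. The strict inequality
      \<open>A0 < C\<close> forces \<open>As k < C\<close> eventually, and there the truncated
      approximations agree with the original ones.\<close>
    define G where "G k \<omega> = y \<omega> * min (D k \<omega>) (exp (2 * C)) * indicator {\<omega>. A0 \<omega> < C} \<omega>" for k \<omega>
    define G0 where "G0 \<omega> = y \<omega> * min (exp (L0 \<omega> - A0 \<omega> / 2)) (exp (2 * C)) * indicator {\<omega>. A0 \<omega> < C} \<omega>" for \<omega>
    have [measurable]: "G k \<in> borel_measurable M" "G0 \<in> borel_measurable M" for k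
      unfolding G_def G0_def by measurable
    have G_nonneg: "0 \<le> G k \<omega>" for k \<omega> using y D0[of k \<omega>] by (simp add: G_def)
    have "(\<integral>\<^sup>+\<omega>. ennreal (y \<omega>) \<partial>M) \<le> (\<integral>\<^sup>+\<omega>. ennreal (G k \<omega>) \<partial>M) + ennreal ((3/2 + K/2) * exp (- C))" for k
    proof -
      \<comment> \<open>Cauchy-Schwarz and Markov in pointwise form: \<open>D^2\<close> carries a
        weight of order \<open>exp (- 2 * C)\<close> against a second moment of at most
        \<open>exp C\<close>, and \<open>exp (3 * A0)\<close> carries one of order
        \<open>exp (- C)\<close>. The coefficient 3/2 is the sum of 1, for values above the cap, and
        1/2, for points with \<open>A0\<close> at least \<open>C\<close>.\<close>
      have pt: "y \<omega> * D k \<omega> \<le> G k \<omega> + (3/2 * exp (- 2 * C)) * (D k \<omega>)\<^sup>2 + (exp (- C) / 2) * exp (3 * A0 \<omega>)" for \<omega>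
      proof -
        have yD: "y \<omega> * D k \<omega> \<le> D k \<omega>" using y[of \<omega>] D0[of k \<omega>] by (simp add: mult_left_le_one_le)
        have am: "D k \<omega> \<le> exp (- 2 * C) * (D k \<omega>)\<^sup>2" if "exp (2 * C) \<le> D k \<omega>"
        proof -
          have "1 \<le> exp (- 2 * C) * D k \<omega>" using that by (simp add: exp_minus field_simps)
          from mult_right_mono[OF this less_imp_le[OF D0[of k \<omega>]]] show ?thesis
            by (simp add: power2_eq_square)
        qed
        have sq: "D k \<omega> \<le> (exp (- 2 * C) * (D k \<omega>)\<^sup>2 + exp (2 * C)) / 2"
        proof -
          have "0 \<le> (exp (- C) * D k \<omega> - exp C)\<^sup>2" by simp
          also have "\<dots> = exp (- 2 * C) * (D k \<omega>)\<^sup>2 + exp (2 * C) - 2 * D k \<omega>"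
            by (simp add: power2_eq_square algebra_simps exp_add[symmetric] mult_exp_exp)
          finally show ?thesis by simp
        qed
        show ?thesis
        proof (cases "A0 \<omega> < C")
          case True
          have "y \<omega> * D k \<omega> \<le> G k \<omega> + exp (- 2 * C) * (D k \<omega>)\<^sup>2"
          proof (cases "D k \<omega> \<le> exp (2 * C)")
            case D: True
            have "G k \<omega> = y \<omega> * D k \<omega>" using True D by (simp add: G_def min_def)
            then show ?thesis by simp
          next
            case False
            then show ?thesis using yD am G_nonneg[of k \<omega>] by linarith
          qed
          moreover have "0 \<le> exp (- 2 * C) * (D k \<omega>)\<^sup>2" "0 \<le> exp (- C) * exp (3 * A0 \<omega>)" by simp_all
          ultimately show ?thesis unfolding times_divide_eq_left mult.assoc by linarith
        next
          case False
          define p where "p = exp (- 2 * C) * (D k \<omega>)\<^sup>2"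
          define q where "q = exp (- C) * exp (3 * A0 \<omega>)"
          have "exp (2 * C) \<le> q" using False by (simp add: q_def exp_add[symmetric])
          moreover have "0 \<le> p" by (simp add: p_def)
          moreover have "2 * D k \<omega> \<le> p + exp (2 * C)" using sq by (simp add: p_def)
          ultimately have "y \<omega> * D k \<omega> \<le> G k \<omega> + 3/2 * p + q / 2"
            using yD G_nonneg[of k \<omega>] by linarith
          then show ?thesis by (simp add: p_def q_def)
        qed
      qed
      have "(\<integral>\<^sup>+\<omega>. ennreal (y \<omega>) \<partial>M) = (\<integral>\<^sup>+\<omega>. ennreal (y \<omega> * D k \<omega>) \<partial>M)" using ED by simp
      also have "\<dots> \<le> (\<integral>\<^sup>+\<omega>. ennreal (G k \<omega>) + ennreal (3/2 * exp (- 2 * C)) * ennreal ((D k \<omega>)\<^sup>2) +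
          ennreal (exp (- C) / 2) * ennreal (exp (3 * A0 \<omega>)) \<partial>M)"
        using pt G_nonneg
        by (intro nn_integral_mono) (simp add: ennreal_mult'[symmetric] ennreal_plus[symmetric] ennreal_leI del: ennreal_plus)
      also have "\<dots> = (\<integral>\<^sup>+\<omega>. ennreal (G k \<omega>) \<partial>M) + ennreal (3/2 * exp (- 2 * C)) * (\<integral>\<^sup>+\<omega>. ennreal ((D k \<omega>)\<^sup>2) \<partial>M) +
          ennreal (exp (- C) / 2) * ennreal K"
        by (simp add: nn_integral_add nn_integral_cmult K)
      also have "\<dots> \<le> (\<integral>\<^sup>+\<omega>. ennreal (G k \<omega>) \<partial>M) + ennreal (3/2 * exp (- 2 * C)) * ennreal (exp C) +
          ennreal (exp (- C) / 2) * ennreal K"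
        by (intro add_mono mult_left_mono D2) auto
      also have "\<dots> = (\<integral>\<^sup>+\<omega>. ennreal (G k \<omega>) \<partial>M) + ennreal ((3/2 + K/2) * exp (- C))"
      proof -
        have "ennreal (3/2 * exp (- 2 * C)) * ennreal (exp C) + ennreal (exp (- C) / 2) * ennreal K =
            ennreal (3/2 * exp (- 2 * C) * exp C + exp (- C) / 2 * K)"
          using K0 by (simp add: ennreal_mult'[symmetric] ennreal_plus[symmetric] del: ennreal_plus)
        also have "3/2 * exp (- 2 * C) * exp C + exp (- C) / 2 * K = (3/2 + K/2) * exp (- C)"
          by (simp add: mult.assoc exp_add[symmetric] algebra_simps)
        finally show ?thesis by (simp add: add.assoc)
      qed
      finally show ?thesis .
    qed
    moreover have "(\<lambda>k. (\<integral>\<^sup>+\<omega>. ennreal (G k \<omega>) \<partial>M) + ennreal ((3/2 + K/2) * exp (- C))) \<longlonglongrightarrow>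
        (\<integral>\<^sup>+\<omega>. ennreal (G0 \<omega>) \<partial>M) + ennreal ((3/2 + K/2) * exp (- C))"
    proof (intro tendsto_add tendsto_const nn_integral_dominated_convergence[where w = "\<lambda>_. ennreal (exp (2 * C))"])
      show "AE \<omega> in M. ennreal (G k \<omega>) \<le> ennreal (exp (2 * C))" for k
      proof (intro AE_I2 ennreal_leI)
        fix \<omega>
        have "y \<omega> * min (D k \<omega>) (exp (2 * C)) \<le> 1 * exp (2 * C)"
          using y[of \<omega>] D0[of k \<omega>] by (intro mult_mono) auto
        then show "G k \<omega> \<le> exp (2 * C)" by (simp add: G_def indicator_def)
      qed
      show "AE \<omega> in M. (\<lambda>k. ennreal (G k \<omega>)) \<longlonglongrightarrow> ennreal (G0 \<omega>)"
        using lim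
      proof eventually_elim
        case (elim \<omega>)
        show ?case
        proof (cases "A0 \<omega> < C")
          case True
          with elim have "\<forall>\<^sub>F k in sequentially. As k \<omega> < C" by (auto dest: order_tendstoD)
          then have ev: "\<forall>\<^sub>F k in sequentially. D k \<omega> = exp (Ls k \<omega> - As k \<omega> / 2)"
            by eventually_elim (use t(3) in \<open>simp add: D_def\<close>)
          have "(\<lambda>k. exp (Ls k \<omega> - As k \<omega> / 2)) \<longlonglongrightarrow> exp (L0 \<omega> - A0 \<omega> / 2)"
            using elim by (intro tendsto_intros) auto
          with ev have "(\<lambda>k. D k \<omega>) \<longlonglongrightarrow> exp (L0 \<omega> - A0 \<omega> / 2)"
            by (simp cong: tendsto_cong)
          then show ?thesis unfolding G_def G0_def by (intro tendsto_intros tendsto_min)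
        qed (simp add: G_def G0_def)
      qed
    qed (auto simp: emeasure_space_1)
    ultimately have "(\<integral>\<^sup>+\<omega>. ennreal (y \<omega>) \<partial>M) \<le> (\<integral>\<^sup>+\<omega>. ennreal (G0 \<omega>) \<partial>M) + ennreal ((3/2 + K/2) * exp (- C))"
      by (intro LIMSEQ_le_const) auto
    also have "(\<integral>\<^sup>+\<omega>. ennreal (G0 \<omega>) \<partial>M) \<le> ?R"
      unfolding R
    proof (intro nn_integral_mono ennreal_leI)
      fix \<omega> show "G0 \<omega> \<le> y \<omega> * exp (L0 \<omega> - A0 \<omega> / 2)"
        using y[of \<omega>] by (auto simp: G0_def indicator_def intro!: mult_left_mono)
    qed
    finally show ?thesis by (simp add: add_right_mono)
  qed
  have "(\<lambda>n. ?R + ennreal ((3/2 + K/2) * exp (- real n))) \<longlonglongrightarrow> ?R + ennreal ((3/2 + K/2) * 0)"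
    by (intro tendsto_intros filterlim_compose[OF exp_at_bot])
      (simp add: filterlim_uminus_at_bot filterlim_real_sequentially)
  then have "(\<lambda>n. ?R + ennreal ((3/2 + K/2) * exp (- real n))) \<longlonglongrightarrow> ?R" by simp
  then show "(\<integral>\<^sup>+\<omega>. ennreal (y \<omega>) \<partial>M) \<le> ?R"
    by (rule LIMSEQ_le_const) (use bound in auto)
qed (rule ito_limit_exponential_le[OF assms(1-3)])

end

section \<open>The Ito integral as a limit of elementary integrals\<close>

lemma ennreal_min_add_le: "min (a + b) 1 \<le> min a 1 + min b (1::ennreal)"
proof (cases "1 \<le> a \<or> 1 \<le> b")
  case True
  then have "1 \<le> min a 1 + min b 1"
    by (metis add_increasing add_increasing2 min_absorb2 order_refl zero_le)
  then show ?thesis by (rule min.coboundedI2)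
next
  case False
  then have "min a 1 = a" "min b 1 = b" by (auto simp: min_def)
  then show ?thesis by simp
qed
lemma ennreal_le_add3: "a \<le> a + b + c" "b \<le> a + b + c" "c \<le> a + b + (c :: ennreal)"
proof -
  show "a \<le> a + b + c" by (metis add.assoc le_iff_add)
  show "b \<le> a + b + c" by (metis add.assoc add.commute le_iff_add)
  show "c \<le> a + b + c" by (metis add.commute le_iff_add)
qed

text \<open>Young's inequality with a parameter \<open>r\<close> bounds the difference of the
  squares by \<open>(1 + 1 / r) * (h - g)^2 + r * g^2\<close>. First \<open>r\<close> is made small,
  then \<open>k\<close> large.\<close>

lemma L2_tendsto_imp_integral_square_tendsto:
  fixes h :: "nat \<Rightarrow> 'b \<Rightarrow> real" and g :: "'b \<Rightarrow> real"
  assumes [measurable]: "\<And>k. h k \<in> borel_measurable N" "g \<in> borel_measurable N"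
    and lim: "(\<lambda>k. \<integral>\<^sup>+u. ennreal ((h k u - g u)\<^sup>2) \<partial>N) \<longlonglongrightarrow> 0"
    and fin: "(\<integral>\<^sup>+u. ennreal ((g u)\<^sup>2) \<partial>N) < \<infinity>"
  shows "(\<lambda>k. \<integral>u. (h k u)\<^sup>2 \<partial>N) \<longlonglongrightarrow> (\<integral>u. (g u)\<^sup>2 \<partial>N)"
proof -
  have ig: "integrable N (\<lambda>u. (g u)\<^sup>2)"
    using fin by (intro integrableI_nonneg) auto
  define G where "G = (\<integral>u. (g u)\<^sup>2 \<partial>N)"
  have G: "0 \<le> G" by (simp add: G_def)
  define d where "d k = (\<integral>u. (h k u - g u)\<^sup>2 \<partial>N)" for k
  \<comment> \<open>For small \<open>k\<close> the distance from \<open>h k\<close> to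
    \<open>g\<close> may be infinite, and the Bochner integral would then have its default value
    0.\<close>
  have ev: "\<forall>\<^sub>F k in sequentially. integrable N (\<lambda>u. (h k u - g u)\<^sup>2)"
  proof -
    have "\<forall>\<^sub>F k in sequentially. (\<integral>\<^sup>+u. ennreal ((h k u - g u)\<^sup>2) \<partial>N) < \<infinity>"
      using lim by (rule order_tendstoD) simp
    then show ?thesis by eventually_elim (intro integrableI_nonneg; simp)
  qed
  have d: "d \<longlonglongrightarrow> 0"
  proof -
    have "(\<lambda>k. enn2real (\<integral>\<^sup>+u. ennreal ((h k u - g u)\<^sup>2) \<partial>N)) \<longlonglongrightarrow> 0"
      using lim by (intro tendsto_enn2real) auto
    then show ?thesis unfolding d_def by (subst integral_eq_nn_integral) auto
  qed
  have est: "\<bar>(\<integral>u. (h k u)\<^sup>2 \<partial>N) - G\<bar> \<le> (1 + 1 / r) * d k + r * G"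
    if i: "integrable N (\<lambda>u. (h k u - g u)\<^sup>2)" and r: "0 < r" for k and r :: real
  proof -
    have a1: "2 * (\<bar>h k u - g u\<bar> * \<bar>g u\<bar>) \<le> (h k u - g u)\<^sup>2 / r + r * (g u)\<^sup>2" for u
    proof -
      have "0 \<le> (\<bar>h k u - g u\<bar> / sqrt r - sqrt r * \<bar>g u\<bar>)\<^sup>2" by simp
      also have "\<dots> = (h k u - g u)\<^sup>2 / r + r * (g u)\<^sup>2 - 2 * (\<bar>h k u - g u\<bar> * \<bar>g u\<bar>)"
        using r by (simp add: power2_diff power_divide power_mult_distrib)
      finally show ?thesis by simp
    qed
    have a2: "\<bar>(h k u)\<^sup>2 - (g u)\<^sup>2\<bar> \<le> (h k u - g u)\<^sup>2 + 2 * (\<bar>h k u - g u\<bar> * \<bar>g u\<bar>)" for u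
    proof -
      have "(h k u)\<^sup>2 - (g u)\<^sup>2 = (h k u - g u)\<^sup>2 + 2 * ((h k u - g u) * g u)"
        by (simp add: power2_eq_square algebra_simps)
      also have "\<bar>\<dots>\<bar> \<le> \<bar>(h k u - g u)\<^sup>2\<bar> + \<bar>2 * ((h k u - g u) * g u)\<bar>" by (rule abs_triangle_ineq)
      finally show ?thesis by (simp add: abs_mult)
    qed
    have pt: "\<bar>(h k u)\<^sup>2 - (g u)\<^sup>2\<bar> \<le> (1 + 1 / r) * (h k u - g u)\<^sup>2 + r * (g u)\<^sup>2" for u
    proof -
      have "(1 + 1 / r) * (h k u - g u)\<^sup>2 = (h k u - g u)\<^sup>2 + (h k u - g u)\<^sup>2 / r"
        by (simp add: distrib_right)
      then show ?thesis using a1[of u] a2[of u] by linarith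
    qed
    have ib: "integrable N (\<lambda>u. (1 + 1 / r) * (h k u - g u)\<^sup>2 + r * (g u)\<^sup>2)"
      using i ig by auto
    have id: "integrable N (\<lambda>u. (h k u)\<^sup>2 - (g u)\<^sup>2)"
      by (rule Bochner_Integration.integrable_bound[OF ib]) (use pt in \<open>auto intro!: AE_I2 order_trans[OF _ abs_ge_self]\<close>)
    have "integrable N (\<lambda>u. ((h k u)\<^sup>2 - (g u)\<^sup>2) + (g u)\<^sup>2)"
      by (rule Bochner_Integration.integrable_add[OF id ig])
    then have ih: "integrable N (\<lambda>u. (h k u)\<^sup>2)" by simp
    have "\<bar>(\<integral>u. (h k u)\<^sup>2 \<partial>N) - G\<bar> = \<bar>\<integral>u. (h k u)\<^sup>2 - (g u)\<^sup>2 \<partial>N\<bar>"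
      unfolding G_def using ih ig by simp
    also have "\<dots> \<le> (\<integral>u. \<bar>(h k u)\<^sup>2 - (g u)\<^sup>2\<bar> \<partial>N)" by (rule integral_abs_bound)
    also have "\<dots> \<le> (\<integral>u. (1 + 1 / r) * (h k u - g u)\<^sup>2 + r * (g u)\<^sup>2 \<partial>N)"
      using id ib pt by (intro integral_mono) auto
    also have "\<dots> = (1 + 1 / r) * d k + r * G"
      using i ig by (simp add: d_def G_def)
    finally show ?thesis .
  qed
  show ?thesis
    unfolding G_def[symmetric]
  proof (rule tendstoI)
    fix e :: real assume e: "0 < e"
    \<comment> \<open>The denominator is \<open>G + 1\<close> because \<open>G\<close> may
      vanish.\<close>
    define r where "r = e / 2 / (G + 1)"
    have r: "0 < r" using e G by (simp add: r_def)
    have rG: "r * G \<le> e / 2"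
    proof -
      have "r * G \<le> r * (G + 1)" using r by (intro mult_left_mono) auto
      also have "\<dots> = e / 2"
        unfolding r_def using G by (intro nonzero_eq_divide_eq[THEN iffD1]) auto
      finally show ?thesis .
    qed
    have "(\<lambda>k. (1 + 1 / r) * d k) \<longlonglongrightarrow> (1 + 1 / r) * 0" by (intro tendsto_intros d)
    then have "\<forall>\<^sub>F k in sequentially. (1 + 1 / r) * d k < e / 2"
      by (rule order_tendstoD) (use e in simp)
    with ev show "\<forall>\<^sub>F k in sequentially. dist (\<integral>u. (h k u)\<^sup>2 \<partial>N) G < e"
    proof eventually_elim
      case (elim k)
      from est[OF elim(1) r] elim(2) rG show ?case unfolding dist_real_def by linarith
    qed
  qed
qed

section \<open>Brackets of simple processes\<close>

lemma simple_data_mono: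
  assumes "simple_data F n \<tau> \<xi>" "i \<le> j" "j \<le> n"
  shows "\<tau> i \<le> \<tau> j"
  using assms(2,3)
proof (induction j rule: dec_induct)
  case (step k)
  then have "\<tau> k < \<tau> (Suc k)" using assms(1) by (simp add: simple_data_def)
  with step show ?case by simp
qed simp

lemma simple_data_nonneg:
  assumes "simple_data F n \<tau> \<xi>" "i \<le> n"
  shows "0 \<le> \<tau> i"
  using simple_data_mono[OF assms(1), of 0 i] assms by (auto simp: simple_data_def)

text \<open>The intervals are disjoint, so the cross terms vanish.\<close>

lemma simple_process_square:
  assumes "simple_data F n \<tau> \<xi>"
  shows "(simple_process n \<tau> \<xi> u \<omega>)\<^sup>2 = (\<Sum>i<n. (\<xi> i \<omega>)\<^sup>2 * indicator {\<tau> i<..\<tau> (Suc i)} u)"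
proof -
  have "(\<Sum>i<k. \<xi> i \<omega> * indicator {\<tau> i<..\<tau> (Suc i)} u)\<^sup>2 =
      (\<Sum>i<k. (\<xi> i \<omega>)\<^sup>2 * indicator {\<tau> i<..\<tau> (Suc i)} u)" if "k \<le> n" for k
    using that
  proof (induction k)
    case (Suc k)
    have "(\<Sum>i<k. \<xi> i \<omega> * indicator {\<tau> i<..\<tau> (Suc i)} u) * indicator {\<tau> k<..\<tau> (Suc k)} u = 0"
      unfolding sum_distrib_right
    proof (rule sum.neutral, rule ballI)
      fix i assume "i \<in> {..<k}"
      then have "\<tau> (Suc i) \<le> \<tau> k" using simple_data_mono[OF assms, of "Suc i" k] Suc by auto
      then show "\<xi> i \<omega> * indicator {\<tau> i<..\<tau> (Suc i)} u * indicator {\<tau> k<..\<tau> (Suc k)} u = 0"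
        by (auto simp: indicator_def)
    qed
    then show ?case using Suc by (simp add: power2_sum power_mult_distrib algebra_simps indicator_def)
  qed simp
  then show ?thesis by (simp add: simple_process_def)
qed

lemma emeasure_lborel_Ioc_max: "emeasure lborel {a<..b::real} = ennreal (max 0 (b - a))"
  by (cases "a \<le> b") auto

lemma integral_indicator_simple_process_square:
  assumes "simple_data F n \<tau> \<xi>" "s \<le> t"
  shows "(\<integral>u. (indicator {s<..t} u * simple_process n \<tau> \<xi> u \<omega>)\<^sup>2 \<partial>lborel) =
    (\<Sum>i<n. (\<xi> i \<omega>)\<^sup>2 * (max s (min t (\<tau> (Suc i))) - max s (min t (\<tau> i))))"
proof -
  have "(\<integral>u. (indicator {s<..t} u * simple_process n \<tau> \<xi> u \<omega>)\<^sup>2 \<partial>lborel) =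
     (\<integral>u. (\<Sum>i<n. (\<xi> i \<omega>)\<^sup>2 * indicator {max s (\<tau> i)<..min t (\<tau> (Suc i))} u) \<partial>lborel)"
  proof (rule Bochner_Integration.integral_cong)
    fix u
    have "(indicator {s<..t} u * simple_process n \<tau> \<xi> u \<omega>)\<^sup>2 =
        indicator {s<..t} u * (\<Sum>i<n. (\<xi> i \<omega>)\<^sup>2 * indicator {\<tau> i<..\<tau> (Suc i)} u)"
      by (simp add: power_mult_distrib simple_process_square[OF assms(1)] indicator_def)
    also have "\<dots> = (\<Sum>i<n. (\<xi> i \<omega>)\<^sup>2 * indicator {max s (\<tau> i)<..min t (\<tau> (Suc i))} u)"
      unfolding sum_distrib_left by (rule sum.cong) (auto simp: indicator_def)
    finally show "(indicator {s<..t} u * simple_process n \<tau> \<xi> u \<omega>)\<^sup>2 =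
      (\<Sum>i<n. (\<xi> i \<omega>)\<^sup>2 * indicator {max s (\<tau> i)<..min t (\<tau> (Suc i))} u)" .
  qed simp
  also have "\<dots> = (\<Sum>i<n. (\<xi> i \<omega>)\<^sup>2 * measure lborel {max s (\<tau> i)<..min t (\<tau> (Suc i))})"
    by (subst Bochner_Integration.integral_sum) (auto simp: emeasure_lborel_Ioc_max)
  also have "\<dots> = (\<Sum>i<n. (\<xi> i \<omega>)\<^sup>2 * (max s (min t (\<tau> (Suc i))) - max s (min t (\<tau> i))))"
  proof (rule sum.cong)
    fix i assume "i \<in> {..<n}"
    then have "\<tau> i < \<tau> (Suc i)" using assms(1) by (auto simp: simple_data_def)
    then have "measure lborel {max s (\<tau> i)<..min t (\<tau> (Suc i))} =
        max s (min t (\<tau> (Suc i))) - max s (min t (\<tau> i))"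
      using assms(2) by (auto simp: measure_def emeasure_lborel_Ioc_max max_def min_def)
    then show "(\<xi> i \<omega>)\<^sup>2 * measure lborel {max s (\<tau> i)<..min t (\<tau> (Suc i))} =
      (\<xi> i \<omega>)\<^sup>2 * (max s (min t (\<tau> (Suc i))) - max s (min t (\<tau> i)))" by simp
  qed simp
  finally show ?thesis .
qed

section \<open>From simple processes to the Ito integral\<close>

context brownian_motion
begin

lemma elementary_integral_simple:
  assumes "simple_data F n \<tau> \<xi>" "s \<le> t"
  shows "elementary_integral F B s t
    (\<lambda>\<omega>. simple_integral B n \<tau> \<xi> t \<omega> - simple_integral B n \<tau> \<xi> s \<omega>)
    (\<lambda>\<omega>. \<integral>u. (indicator {s<..t} u * simple_process n \<tau> \<xi> u \<omega>)\<^sup>2 \<partial>lborel)"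
proof -
  \<comment> \<open>\<open>c\<close> clamps the nodes to \<open>[s, t]\<close>; pieces outside this
    interval collapse to length 0.\<close>
  define c where "c u = max s (min t u)" for u
  have c: "c u \<le> c v" if "u \<le> v" for u v using that by (auto simp: c_def)
  have *: "elementary_integral F B s (c (\<tau> k))
    (\<lambda>\<omega>. \<Sum>i<k. \<xi> i \<omega> * (B (c (\<tau> (Suc i))) \<omega> - B (c (\<tau> i)) \<omega>))
    (\<lambda>\<omega>. \<Sum>i<k. (\<xi> i \<omega>)\<^sup>2 * (c (\<tau> (Suc i)) - c (\<tau> i)))" if "k \<le> n" for k
    using that
  proof (induction k)
    case 0
    have "s \<le> c (\<tau> 0)" by (simp add: c_def)
    from elementary_integral_extend[OF elementary_integral.start this] show ?case by simp
  next
    case (Suc k)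
    have le: "c (\<tau> k) \<le> c (\<tau> (Suc k))"
      using Suc assms(1) by (intro c) (auto simp: simple_data_def less_imp_le)
    \<comment> \<open>A node before \<open>s\<close> is moved up, which only enlarges the
      sigma-algebra available to \<open>\<xi> k\<close>. A node from \<open>t\<close> on is moved
      down to \<open>t\<close>, where \<open>\<xi> k\<close> need not be measurable; its piece is
      then empty and nothing is appended.\<close>
    show ?case
    proof (cases "\<tau> k < t")
      case True
      then have "\<tau> k \<le> c (\<tau> k)" by (auto simp: c_def)
      moreover have "\<xi> k \<in> borel_measurable (F (\<tau> k))"
        using assms(1) Suc by (auto simp: simple_data_def)
      ultimately have "\<xi> k \<in> borel_measurable (F (c (\<tau> k)))" by (blast intro: measurable_mono)
      from elementary_integral.append[OF Suc.IH le this] Suc.prems show ?thesis by simp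
    next
      case False
      moreover have "\<tau> k \<le> \<tau> (Suc k)" using simple_data_mono[OF assms(1)] Suc by simp
      ultimately have "c (\<tau> k) = t" "c (\<tau> (Suc k)) = t" using assms(2) by (auto simp: c_def)
      with Suc show ?thesis by simp
    qed
  qed
  have "c (\<tau> n) \<le> t" using assms(2) by (simp add: c_def)
  from elementary_integral_extend[OF *[OF order_refl] this]
  have "elementary_integral F B s t
    (\<lambda>\<omega>. \<Sum>i<n. \<xi> i \<omega> * (B (c (\<tau> (Suc i))) \<omega> - B (c (\<tau> i)) \<omega>))
    (\<lambda>\<omega>. \<Sum>i<n. (\<xi> i \<omega>)\<^sup>2 * (c (\<tau> (Suc i)) - c (\<tau> i)))" .
  moreover have "(\<Sum>i<n. \<xi> i \<omega> * (B (c (\<tau> (Suc i))) \<omega> - B (c (\<tau> i)) \<omega>)) =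
      simple_integral B n \<tau> \<xi> t \<omega> - simple_integral B n \<tau> \<xi> s \<omega>" for \<omega>
  proof -
    have "B (c u) \<omega> - B s \<omega> = B (min t u) \<omega> - B (min s u) \<omega>" for u
      using assms(2) by (cases "u \<le> s"; cases "u \<le> t") (auto simp: c_def min_def max_def)
    then have "B (c u) \<omega> - B (c v) \<omega> =
        (B (min t u) \<omega> - B (min t v) \<omega>) - (B (min s u) \<omega> - B (min s v) \<omega>)" for u v
      by (smt (verit))
    then show ?thesis
      by (simp add: simple_integral_def sum_subtractf[symmetric] right_diff_distrib)
  qed
  ultimately show ?thesis
    by (simp add: integral_indicator_simple_process_square[OF assms] c_def)
qed

text \<open>Joint measurability is used twice: through Tonelli for the squared error, and through
  sections for the integrals along single paths.\<close>

lemma progressively_measurable_joint: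
  assumes "progressively_measurable F H" "0 \<le> t"
  shows "(\<lambda>(\<omega>, u). H u \<omega>) \<in> borel_measurable (M \<Otimes>\<^sub>M restrict_space lborel {0..t})"
proof -
  let ?N = "restrict_space lborel {0..t} :: real measure"
  have 1: "(\<lambda>(u, \<omega>). H u \<omega>) \<in> borel_measurable (restrict_space borel {0..t} \<Otimes>\<^sub>M F t)"
    using assms by (auto simp: progressively_measurable_def)
  have f: "fst \<in> measurable (M \<Otimes>\<^sub>M ?N) (F t)"
    by (rule measurable_compose[OF measurable_fst, of "\<lambda>\<omega>. \<omega>"]) (rule measurable_subalg[where t = t], simp)
  have "sets ?N = sets (restrict_space borel {0..t})"
    by (simp add: sets_restrict_space)
  then have "snd \<in> measurable (M \<Otimes>\<^sub>M ?N) (restrict_space borel {0..t})"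
    using measurable_snd[of M ?N] measurable_cong_sets by blast
  from measurable_compose[OF measurable_Pair[OF this f] 1] show ?thesis
    by (simp add: case_prod_beta)
qed

lemma simple_process_joint:
  assumes "simple_data F n \<tau> \<xi>"
  shows "(\<lambda>(\<omega>, u). simple_process n \<tau> \<xi> u \<omega>) \<in> borel_measurable (M \<Otimes>\<^sub>M restrict_space lborel {0..t})"
proof -
  have [measurable]: "(\<lambda>u. u) \<in> borel_measurable (restrict_space lborel {0..t})"
    by (rule measurable_restrict_space1) simp
  have [measurable]: "i < n \<Longrightarrow> \<xi> i \<in> borel_measurable M" for i
    using assms by (intro measurable_subalg[of _ "\<tau> i"]) (auto simp: simple_data_def)
  have "(\<lambda>(\<omega>, u). simple_process n \<tau> \<xi> u \<omega>) =
      (\<lambda>p. \<Sum>i<n. \<xi> i (fst p) * indicator {\<tau> i<..\<tau> (Suc i)} (snd p))"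
    by (auto simp: simple_process_def fun_eq_iff)
  also have "\<dots> \<in> borel_measurable (M \<Otimes>\<^sub>M restrict_space lborel {0..t})"
    by (rule borel_measurable_sum) measurable
  finally show ?thesis .
qed

lemma L2_error_measurable:
  assumes "simple_data F n \<tau> \<xi>" "progressively_measurable F H" "0 \<le> t"
  shows "(\<lambda>\<omega>. \<integral>\<^sup>+u\<in>{0..t}. ennreal ((simple_process n \<tau> \<xi> u \<omega> - H u \<omega>)\<^sup>2) \<partial>lborel) \<in> borel_measurable M"
proof -
  let ?N = "restrict_space lborel {0..t} :: real measure"
  have [measurable]: "(\<lambda>(\<omega>, u). simple_process n \<tau> \<xi> u \<omega>) \<in> borel_measurable (M \<Otimes>\<^sub>M ?N)"
      "(\<lambda>(\<omega>, u). H u \<omega>) \<in> borel_measurable (M \<Otimes>\<^sub>M ?N)"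
    using simple_process_joint[OF assms(1)] progressively_measurable_joint[OF assms(2,3)] by auto
  have "finite_measure ?N"
    by (rule finite_measureI) (use assms(3) in \<open>simp add: emeasure_restrict_space space_restrict_space\<close>)
  then interpret N: sigma_finite_measure ?N
    by (simp add: finite_measure_def)
  have "(\<lambda>\<omega>. \<integral>\<^sup>+u. ennreal ((simple_process n \<tau> \<xi> u \<omega> - H u \<omega>)\<^sup>2) \<partial>?N) \<in> borel_measurable M"
    by (rule N.borel_measurable_nn_integral) measurable
  then show ?thesis
    by (simp add: nn_integral_restrict_space)
qed

lemma simple_integral_measurable:
  assumes "simple_data F n \<tau> \<xi>" "0 \<le> t"
  shows "simple_integral B n \<tau> \<xi> t \<in> borel_measurable M"
proof -
  have "i < n \<Longrightarrow> \<xi> i \<in> borel_measurable M" for i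
    using assms by (intro measurable_subalg[of _ "\<tau> i"]) (auto simp: simple_data_def)
  moreover have "B (min t (\<tau> i)) \<in> borel_measurable M" if "i \<le> n" for i
    using simple_data_nonneg[OF assms(1) that] assms(2) by (intro measurable_subalg[OF adapted]) auto
  ultimately show ?thesis
    unfolding simple_integral_def[abs_def]
    by (intro borel_measurable_sum borel_measurable_times borel_measurable_diff) auto
qed

text \<open>All nodes are nonnegative, so every simple integral is 0 at time 0. The initial value
  \<open>X 0 = x\<close> of a solution rests on this, as the definition states only the integral
  equation.\<close>

lemma ito_integral_start:
  assumes "has_ito_integral M F B H I"
  shows "AE \<omega> in M. I 0 \<omega> = 0"
proof -
  from assms obtain n \<tau> \<xi> where sd: "\<And>m. simple_data F (n m) (\<tau> m) (\<xi> m)"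
    and v: "vanishes_in_prob M (\<lambda>m \<omega>. ennreal \<bar>simple_integral B (n m) (\<tau> m) (\<xi> m) 0 \<omega> - I 0 \<omega>\<bar>)"
    and [measurable]: "I 0 \<in> borel_measurable M"
    unfolding has_ito_integral_def by fastforce
  have "simple_integral B (n m) (\<tau> m) (\<xi> m) 0 \<omega> = 0" for m \<omega>
    unfolding simple_integral_def using simple_data_nonneg[OF sd]
    by (intro sum.neutral) (auto simp: min_absorb1)
  then have "vanishes_in_prob M (\<lambda>m \<omega>. ennreal \<bar>I 0 \<omega>\<bar>)" using v by simp
  from vanishes_in_prob_imp_nn_integral_min[OF _ this]
  have "(\<integral>\<^sup>+\<omega>. min (ennreal \<bar>I 0 \<omega>\<bar>) 1 \<partial>M) = 0"
    by (simp add: LIMSEQ_const_iff)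
  then have "AE \<omega> in M. min (ennreal \<bar>I 0 \<omega>\<bar>) 1 = 0"
    by (subst (asm) nn_integral_0_iff_AE) auto
  then show ?thesis by eventually_elim (auto simp: min_def split: if_splits)
qed

text \<open>Three errors are made small together: the squared distance of the integrands on
  \<open>[0, t]\<close> and the errors of the integrals at \<open>t\<close> and at \<open>s\<close>.
  The first controls the bracket along almost every path.\<close>

lemma ito_integral_imp_ito_limit:
  assumes "has_ito_integral M F B H I" "0 \<le> s" "s \<le> t"
  shows "ito_limit M F B s t (\<lambda>\<omega>. I t \<omega> - I s \<omega>)
    (\<lambda>\<omega>. \<integral>u. (indicator {s<..t} u * H u \<omega>)\<^sup>2 \<partial>lborel)"
proof -
  have t: "0 \<le> t" using assms by simp
  from assms(1) obtain n \<tau> \<xi> where sd: "\<And>m. simple_data F (n m) (\<tau> m) (\<xi> m)"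
    and v: "\<forall>t\<ge>0. vanishes_in_prob M (\<lambda>m \<omega>.
          \<integral>\<^sup>+u\<in>{0..t}. ennreal ((simple_process (n m) (\<tau> m) (\<xi> m) u \<omega> - H u \<omega>)\<^sup>2) \<partial>lborel) \<and>
        vanishes_in_prob M (\<lambda>m \<omega>. ennreal \<bar>simple_integral B (n m) (\<tau> m) (\<xi> m) t \<omega> - I t \<omega>\<bar>)"
    unfolding has_ito_integral_def by blast
  from assms(1) have pm: "progressively_measurable F H"
    and fin: "AE \<omega> in M. \<forall>t\<ge>0. (\<integral>\<^sup>+u\<in>{0..t}. ennreal ((H u \<omega>)\<^sup>2) \<partial>lborel) < \<infinity>"
    and I: "\<forall>t\<ge>0. I t \<in> borel_measurable M"
    unfolding has_ito_integral_def by auto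
  have [measurable]: "I s \<in> borel_measurable M" "I t \<in> borel_measurable M" using I assms by auto
  have [measurable]: "simple_integral B (n m) (\<tau> m) (\<xi> m) t \<in> borel_measurable M"
      "simple_integral B (n m) (\<tau> m) (\<xi> m) s \<in> borel_measurable M" for m
    using simple_integral_measurable[OF sd] assms by auto
  define Y where "Y m \<omega> = (\<integral>\<^sup>+u\<in>{0..t}. ennreal ((simple_process (n m) (\<tau> m) (\<xi> m) u \<omega> - H u \<omega>)\<^sup>2) \<partial>lborel)" for m \<omega>
  define Z where "Z r m \<omega> = ennreal \<bar>simple_integral B (n m) (\<tau> m) (\<xi> m) r \<omega> - I r \<omega>\<bar>" for r m \<omega>
  have [measurable]: "Y m \<in> borel_measurable M" "Z t m \<in> borel_measurable M" "Z s m \<in> borel_measurable M" for m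
    unfolding Y_def[abs_def] Z_def[abs_def] using L2_error_measurable[OF sd pm t] by auto
  have "vanishes_in_prob M Y" "vanishes_in_prob M (Z t)" "vanishes_in_prob M (Z s)"
    using v t assms(2) unfolding Y_def[abs_def] Z_def[abs_def] by blast+
  then have lim: "(\<lambda>k. \<integral>\<^sup>+\<omega>. min (Y k \<omega>) 1 \<partial>M) \<longlonglongrightarrow> 0" "(\<lambda>k. \<integral>\<^sup>+\<omega>. min (Z t k \<omega>) 1 \<partial>M) \<longlonglongrightarrow> 0"
      "(\<lambda>k. \<integral>\<^sup>+\<omega>. min (Z s k \<omega>) 1 \<partial>M) \<longlonglongrightarrow> 0"
    by (auto intro!: vanishes_in_prob_imp_nn_integral_min)
  have lim': "(\<lambda>k. \<integral>\<^sup>+\<omega>. min (Y k \<omega> + Z t k \<omega> + Z s k \<omega>) 1 \<partial>M) \<longlonglongrightarrow> 0"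
  proof (rule tendsto_sandwich[OF _ _ tendsto_const])
    show "(\<lambda>k. (\<integral>\<^sup>+\<omega>. min (Y k \<omega>) 1 \<partial>M) + (\<integral>\<^sup>+\<omega>. min (Z t k \<omega>) 1 \<partial>M) + (\<integral>\<^sup>+\<omega>. min (Z s k \<omega>) 1 \<partial>M)) \<longlonglongrightarrow> 0"
      using tendsto_add[OF tendsto_add[OF lim(1,2)] lim(3)] by simp
    have "min (a + b + c) 1 \<le> min a 1 + min b 1 + min c 1" for a b c :: ennreal
      by (rule order_trans[OF ennreal_min_add_le add_right_mono[OF ennreal_min_add_le]])
    then have "(\<integral>\<^sup>+\<omega>. min (Y k \<omega> + Z t k \<omega> + Z s k \<omega>) 1 \<partial>M) \<le>
        (\<integral>\<^sup>+\<omega>. min (Y k \<omega>) 1 + min (Z t k \<omega>) 1 + min (Z s k \<omega>) 1 \<partial>M)" for k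
      by (intro nn_integral_mono)
    also have "\<dots> k = (\<integral>\<^sup>+\<omega>. min (Y k \<omega>) 1 \<partial>M) + (\<integral>\<^sup>+\<omega>. min (Z t k \<omega>) 1 \<partial>M) + (\<integral>\<^sup>+\<omega>. min (Z s k \<omega>) 1 \<partial>M)" for k
      by (simp add: nn_integral_add)
    finally show "\<forall>\<^sub>F k in sequentially. (\<integral>\<^sup>+\<omega>. min (Y k \<omega> + Z t k \<omega> + Z s k \<omega>) 1 \<partial>M) \<le>
        (\<integral>\<^sup>+\<omega>. min (Y k \<omega>) 1 \<partial>M) + (\<integral>\<^sup>+\<omega>. min (Z t k \<omega>) 1 \<partial>M) + (\<integral>\<^sup>+\<omega>. min (Z s k \<omega>) 1 \<partial>M)"
      by simp
  qed auto
  \<comment> \<open>The error does not depend on \<open>N\<close> here; for each \<open>N\<close> an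
    index is picked whose capped expected error is below \<open>(1/2)^N\<close>.\<close>
  obtain \<kappa> where \<kappa>: "AE \<omega> in M. (\<lambda>N. Y (\<kappa> N) \<omega> + Z t (\<kappa> N) \<omega> + Z s (\<kappa> N) \<omega>) \<longlonglongrightarrow> 0"
    using AE_tendsto_diagonal[of "\<lambda>N k \<omega>. Y k \<omega> + Z t k \<omega> + Z s k \<omega>", OF _ lim'] by auto
  show ?thesis
    unfolding ito_limit_def
  proof (intro exI conjI allI)
    show "elementary_integral F B s t
      (\<lambda>\<omega>. simple_integral B (n (\<kappa> k)) (\<tau> (\<kappa> k)) (\<xi> (\<kappa> k)) t \<omega> - simple_integral B (n (\<kappa> k)) (\<tau> (\<kappa> k)) (\<xi> (\<kappa> k)) s \<omega>)
      (\<lambda>\<omega>. \<integral>u. (indicator {s<..t} u * simple_process (n (\<kappa> k)) (\<tau> (\<kappa> k)) (\<xi> (\<kappa> k)) u \<omega>)\<^sup>2 \<partial>lborel)" for k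
      by (rule elementary_integral_simple[OF sd assms(3)])
    show "AE \<omega> in M. (\<lambda>k. simple_integral B (n (\<kappa> k)) (\<tau> (\<kappa> k)) (\<xi> (\<kappa> k)) t \<omega> -
          simple_integral B (n (\<kappa> k)) (\<tau> (\<kappa> k)) (\<xi> (\<kappa> k)) s \<omega>) \<longlonglongrightarrow> I t \<omega> - I s \<omega> \<and>
        (\<lambda>k. \<integral>u. (indicator {s<..t} u * simple_process (n (\<kappa> k)) (\<tau> (\<kappa> k)) (\<xi> (\<kappa> k)) u \<omega>)\<^sup>2 \<partial>lborel) \<longlonglongrightarrow>
        (\<integral>u. (indicator {s<..t} u * H u \<omega>)\<^sup>2 \<partial>lborel)"
      using \<kappa> fin AE_space
    proof eventually_elim
      case (elim \<omega>)
      have Z0: "(\<lambda>k. simple_integral B (n (\<kappa> k)) (\<tau> (\<kappa> k)) (\<xi> (\<kappa> k)) r \<omega>) \<longlonglongrightarrow> I r \<omega>" if r: "r = t \<or> r = s" for r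
      proof -
        have "(\<lambda>k. Z r (\<kappa> k) \<omega>) \<longlonglongrightarrow> 0"
          by (rule tendsto_sandwich[OF _ _ tendsto_const elim(1)])
            (use r ennreal_le_add3 in \<open>auto intro!: always_eventually\<close>)
        then have "(\<lambda>k. enn2real (Z r (\<kappa> k) \<omega>)) \<longlonglongrightarrow> 0" by (intro tendsto_enn2real) auto
        then show ?thesis by (simp add: Z_def tendsto_rabs_zero_iff LIM_zero_iff)
      qed
      have Y0: "(\<lambda>k. Y (\<kappa> k) \<omega>) \<longlonglongrightarrow> 0"
        by (rule tendsto_sandwich[OF _ _ tendsto_const elim(1)])
          (use ennreal_le_add3 in \<open>auto intro!: always_eventually\<close>)
      \<comment> \<open>The section of \<open>H\<close> is measurable on \<open>{0..t}\<close> only;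
        the indicator carries this over to the whole line.\<close>
      have Hm: "(\<lambda>u. indicator {s<..t} u * H u \<omega>) \<in> borel_measurable lborel"
      proof -
        have "(\<lambda>u. H u \<omega>) \<in> borel_measurable (restrict_space lborel {0..t})"
          using measurable_Pair2[OF progressively_measurable_joint[OF pm t] elim(3)] by simp
        then have "(\<lambda>u. H u \<omega> * indicator {0..t} u) \<in> borel_measurable lborel"
          by (subst (asm) borel_measurable_restrict_space_iff) (auto simp: mult.commute)
        then have "(\<lambda>u. indicator {s<..t} u * (H u \<omega> * indicator {0..t} u)) \<in> borel_measurable lborel"
          by measurable
        moreover have "indicator {s<..t} u * (H u \<omega> * indicator {0..t} u) = indicator {s<..t} u * H u \<omega>" for u
          using assms(2) by (auto simp: indicator_def)
        ultimately show ?thesis by simp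
      qed
      have "(\<lambda>k. \<integral>u. (indicator {s<..t} u * simple_process (n (\<kappa> k)) (\<tau> (\<kappa> k)) (\<xi> (\<kappa> k)) u \<omega>)\<^sup>2 \<partial>lborel) \<longlonglongrightarrow>
        (\<integral>u. (indicator {s<..t} u * H u \<omega>)\<^sup>2 \<partial>lborel)"
      proof (rule L2_tendsto_imp_integral_square_tendsto[OF _ Hm])
        show "(\<lambda>u. indicator {s<..t} u * simple_process (n (\<kappa> k)) (\<tau> (\<kappa> k)) (\<xi> (\<kappa> k)) u \<omega>) \<in> borel_measurable lborel" for k
          unfolding simple_process_def by measurable
        show "(\<lambda>k. \<integral>\<^sup>+u. ennreal ((indicator {s<..t} u * simple_process (n (\<kappa> k)) (\<tau> (\<kappa> k)) (\<xi> (\<kappa> k)) u \<omega> -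
            indicator {s<..t} u * H u \<omega>)\<^sup>2) \<partial>lborel) \<longlonglongrightarrow> 0"
        proof (rule tendsto_sandwich[OF _ _ tendsto_const Y0])
          show "\<forall>\<^sub>F k in sequentially. (\<integral>\<^sup>+u. ennreal ((indicator {s<..t} u * simple_process (n (\<kappa> k)) (\<tau> (\<kappa> k)) (\<xi> (\<kappa> k)) u \<omega> -
              indicator {s<..t} u * H u \<omega>)\<^sup>2) \<partial>lborel) \<le> Y (\<kappa> k) \<omega>"
            unfolding Y_def using assms(2)
            by (intro always_eventually allI nn_integral_mono) (auto simp: indicator_def)
        qed simp
        have "(\<integral>\<^sup>+u. ennreal ((indicator {s<..t} u * H u \<omega>)\<^sup>2) \<partial>lborel) \<le>
            (\<integral>\<^sup>+u\<in>{0..t}. ennreal ((H u \<omega>)\<^sup>2) \<partial>lborel)"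
          using assms(2) by (intro nn_integral_mono) (auto simp: indicator_def)
        also have "\<dots> < \<infinity>" using elim(2) t by blast
        finally show "(\<integral>\<^sup>+u. ennreal ((indicator {s<..t} u * H u \<omega>)\<^sup>2) \<partial>lborel) < \<infinity>" .
      qed
      moreover from Z0 have "(\<lambda>k. simple_integral B (n (\<kappa> k)) (\<tau> (\<kappa> k)) (\<xi> (\<kappa> k)) t \<omega> -
          simple_integral B (n (\<kappa> k)) (\<tau> (\<kappa> k)) (\<xi> (\<kappa> k)) s \<omega>) \<longlonglongrightarrow> I t \<omega> - I s \<omega>"
        by (intro tendsto_diff) auto
      ultimately show ?case by blast
    qed
  qed
qed

end

section \<open>Integrals against a squared Bessel process\<close>

lemma continuous_on_bounded_real:
  fixes f :: "real \<Rightarrow> real"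
  assumes "continuous_on {s..t} f"
  obtains K where "0 < K" "\<And>u. u \<in> {s..t} \<Longrightarrow> \<bar>f u\<bar> \<le> K"
proof -
  have "bounded (f ` {s..t})"
    by (intro compact_imp_bounded compact_continuous_image assms) simp
  then show thesis using that unfolding bounded_pos by auto
qed

text \<open>Only \<open>\<phi>\<close> is sampled, because in the application the integrals of
  \<open>\<psi>\<close> over the cells occur exactly. The tags are free since summation by parts
  puts one factor at left and the other at right end points. The proof combines uniform continuity
  of \<open>\<phi>\<close> with boundedness of \<open>\<psi>\<close>.\<close>

lemma riemann_sum_tendsto:
  fixes \<phi> \<psi> :: "real \<Rightarrow> real" and p r :: "nat \<Rightarrow> nat \<Rightarrow> real"
  assumes p_def: "\<And>N j. p N j = s + real j * (t - s) / real (Suc N)"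
    and "s \<le> t" and \<phi>: "continuous_on {s..t} \<phi>" and \<psi>: "continuous_on {s..t} \<psi>"
    and r: "\<And>N j. j \<le> N \<Longrightarrow> r N j \<in> {p N j..p N (Suc j)}"
  shows "(\<lambda>N. \<Sum>j<Suc N. \<phi> (r N j) * integral {p N j..p N (Suc j)} \<psi>) \<longlonglongrightarrow> integral {s..t} (\<lambda>u. \<phi> u * \<psi> u)"
proof -
  have step: "p N (Suc j) = p N j + (t - s) / real (Suc N)" for N j
    by (simp add: p_def add_divide_distrib distrib_right)
  have p_le: "p N j \<le> p N (Suc j)" for N j
    unfolding step using \<open>s \<le> t\<close> by simp
  have p_ge: "s \<le> p N j" for N j using \<open>s \<le> t\<close> by (simp add: p_def)
  have p_last: "p N (Suc N) = t" for N by (simp add: p_def)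
  have p_upper: "p N j \<le> t" if "j \<le> Suc N" for N j
    using that lift_Suc_mono_le[of "p N", OF p_le that] p_last by simp
  have cont: "continuous_on {s..t} (\<lambda>u. \<phi> u * \<psi> u)" by (intro continuous_intros \<phi> \<psi>)
  have split: "integral {s..p N k} (\<lambda>u. \<phi> u * \<psi> u) = (\<Sum>j<k. integral {p N j..p N (Suc j)} (\<lambda>u. \<phi> u * \<psi> u))"
    if "k \<le> Suc N" for N k
    using that
  proof (induction k)
    case 0
    then show ?case by (simp add: p_def)
  next
    case (Suc k)
    have "(\<lambda>u. \<phi> u * \<psi> u) integrable_on {s..p N (Suc k)}"
      using p_upper[OF Suc.prems]
      by (intro integrable_continuous_interval continuous_on_subset[OF cont]) auto
    from Henstock_Kurzweil_Integration.integral_combine[OF p_ge p_le this] Suc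
    show ?case by simp
  qed
  obtain K where K: "0 < K" "\<And>u. u \<in> {s..t} \<Longrightarrow> \<bar>\<psi> u\<bar> \<le> K"
    using continuous_on_bounded_real[OF \<psi>] by metis
  show ?thesis
  proof (rule tendstoI)
    fix e :: real assume e: "0 < e"
    \<comment> \<open>\<open>t - s + 1\<close> keeps the denominator positive when
      \<open>s = t\<close>.\<close>
    define d where "d = e / (2 * (K * (t - s + 1)))"
    have d: "0 < d" using e K \<open>s \<le> t\<close> by (simp add: d_def)
    have dK: "d * K * (t - s) < e"
    proof -
      have "d * K * (t - s) \<le> d * (K * (t - s + 1))" using d K by (simp add: mult.assoc mult_left_mono)
      also have "\<dots> = e / 2" using K \<open>s \<le> t\<close> by (simp add: d_def)
      finally show ?thesis using e by linarith
    qed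
    have "uniformly_continuous_on {s..t} \<phi>" by (intro compact_uniformly_continuous \<phi>) simp
    then obtain \<delta> where \<delta>: "0 < \<delta>" "\<And>u v. u \<in> {s..t} \<Longrightarrow> v \<in> {s..t} \<Longrightarrow> \<bar>v - u\<bar> < \<delta> \<Longrightarrow> \<bar>\<phi> v - \<phi> u\<bar> < d"
      unfolding uniformly_continuous_on_def dist_real_def using d by metis
    have "(\<lambda>N. (t - s) * inverse (real (Suc N))) \<longlonglongrightarrow> (t - s) * 0"
      by (intro tendsto_intros LIMSEQ_inverse_real_of_nat)
    then have "\<forall>\<^sub>F N in sequentially. (t - s) * inverse (real (Suc N)) < \<delta>"
      by (rule order_tendstoD) (use \<delta> in simp)
    then show "\<forall>\<^sub>F N in sequentially. dist (\<Sum>j<Suc N. \<phi> (r N j) * integral {p N j..p N (Suc j)} \<psi>)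
        (integral {s..t} (\<lambda>u. \<phi> u * \<psi> u)) < e"
    proof eventually_elim
      case (elim N)
      have "\<bar>\<phi> (r N j) * integral {p N j..p N (Suc j)} \<psi> - integral {p N j..p N (Suc j)} (\<lambda>u. \<phi> u * \<psi> u)\<bar> \<le>
          d * K * (p N (Suc j) - p N j)" if j: "j < Suc N" for j
      proof -
        have sub: "{p N j..p N (Suc j)} \<subseteq> {s..t}" using p_ge p_upper[of "Suc j" N] j by auto
        have i\<psi>: "\<psi> integrable_on {p N j..p N (Suc j)}"
          by (intro integrable_continuous_interval continuous_on_subset[OF \<psi> sub])
        have i\<phi>\<psi>: "(\<lambda>u. \<phi> u * \<psi> u) integrable_on {p N j..p N (Suc j)}"
          by (intro integrable_continuous_interval continuous_on_subset[OF cont sub])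
        have "((\<lambda>u. \<phi> (r N j) * \<psi> u - \<phi> u * \<psi> u) has_integral
            (\<phi> (r N j) * integral {p N j..p N (Suc j)} \<psi> - integral {p N j..p N (Suc j)} (\<lambda>u. \<phi> u * \<psi> u)))
            (cbox (p N j) (p N (Suc j)))"
          unfolding cbox_interval using i\<psi> i\<phi>\<psi>
          by (intro has_integral_diff has_integral_mult_right integrable_integral)
        moreover have "norm (\<phi> (r N j) * \<psi> u - \<phi> u * \<psi> u) \<le> d * K" if u: "u \<in> cbox (p N j) (p N (Suc j))" for u
        proof -
          have rN: "r N j \<in> {p N j..p N (Suc j)}" using r j by simp
          have "\<bar>r N j - u\<bar> \<le> (t - s) * inverse (real (Suc N))"
            using rN u step[of N j] by (auto simp: divide_inverse abs_le_iff)
          then have "\<bar>\<phi> (r N j) - \<phi> u\<bar> < d"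
            using rN u sub elim by (intro \<delta>(2)) auto
          moreover have "\<bar>\<psi> u\<bar> \<le> K" using u sub K by auto
          moreover have "\<phi> (r N j) * \<psi> u - \<phi> u * \<psi> u = (\<phi> (r N j) - \<phi> u) * \<psi> u" by (simp add: left_diff_distrib)
          ultimately show ?thesis using d by (simp add: abs_mult mult_mono)
        qed
        ultimately have "norm (\<phi> (r N j) * integral {p N j..p N (Suc j)} \<psi> - integral {p N j..p N (Suc j)} (\<lambda>u. \<phi> u * \<psi> u)) \<le>
            d * K * measure lborel (cbox (p N j) (p N (Suc j)))"
          using d K by (intro has_integral_bound[where f = "\<lambda>u. \<phi> (r N j) * \<psi> u - \<phi> u * \<psi> u"]) auto
        then show ?thesis using p_le[of N j] by simp
      qed
      then have "(\<Sum>j<Suc N. \<bar>\<phi> (r N j) * integral {p N j..p N (Suc j)} \<psi> - integral {p N j..p N (Suc j)} (\<lambda>u. \<phi> u * \<psi> u)\<bar>) \<le>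
          (\<Sum>j<Suc N. d * K * (p N (Suc j) - p N j))"
        by (intro sum_mono) auto
      also have "\<dots> = d * K * (t - s)"
        by (simp only: sum_distrib_left[symmetric] sum_lessThan_telescope p_last) (simp add: p_def)
      finally have "\<bar>\<Sum>j<Suc N. \<phi> (r N j) * integral {p N j..p N (Suc j)} \<psi> - integral {p N j..p N (Suc j)} (\<lambda>u. \<phi> u * \<psi> u)\<bar> \<le> d * K * (t - s)"
        by (intro order_trans[OF sum_abs])
      then show ?case
        using dK split[of "Suc N" N] unfolding p_last by (simp only: dist_real_def sum_subtractf)
    qed
  qed
qed

lemma integral_indicator_sqrt_square:
  fixes f :: "real \<Rightarrow> real"
  assumes "continuous_on {s..t} f" "\<And>u. u \<in> {s..t} \<Longrightarrow> 0 \<le> f u"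
  shows "(\<integral>u. (indicator {s<..t} u * sqrt (f u))\<^sup>2 \<partial>lborel) = integral {s..t} f"
proof -
  have si: "set_integrable lborel {s<..t} f"
    by (rule set_integrable_subset[OF borel_integrable_atLeastAtMost'[OF assms(1)]]) auto
  have "(\<integral>u. (indicator {s<..t} u * sqrt (f u))\<^sup>2 \<partial>lborel) = (LINT u:{s<..t}|lborel. f u)"
    unfolding set_lebesgue_integral_def
    by (intro Bochner_Integration.integral_cong) (auto simp: indicator_def assms(2))
  also have "\<dots> = integral {s<..t} f"
    by (rule set_borel_integral_eq_integral[OF si])
  also have "\<dots> = integral {s..t} f"
    by (rule integral_spike_set) (auto intro: negligible_subset[of "{s}"])
  finally show ?thesis .
qed

section \<open>Paths of a solution and integrals against its martingale part\<close>

locale squared_bessel = brownian_motion M F B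
  for M :: "'a measure" and F B +
  fixes \<Delta> \<theta> :: "real \<Rightarrow> real" and x :: real and X :: "real \<Rightarrow> 'a \<Rightarrow> real"
  assumes continuous_\<Delta>: "continuous_on {0..} \<Delta>"
    and continuous_\<theta>: "continuous_on {0..} \<theta>"
    and \<theta>_nonpos: "0 \<le> u \<Longrightarrow> \<theta> u \<le> 0"
    and solution: "gen_squared_bessel_II M F B \<Delta> \<theta> x X"
begin

lemma X_adapted: "0 \<le> t \<Longrightarrow> X t \<in> borel_measurable (F t)"
  using solution by (auto simp: gen_squared_bessel_II_def)

lemma X_measurable: "0 \<le> t \<Longrightarrow> X t \<in> borel_measurable M"
  using X_adapted measurable_subalg by blast

definition regular_path :: "'a \<Rightarrow> bool" where
  "regular_path \<omega> \<longleftrightarrow> continuous_on {0..} (\<lambda>t. X t \<omega>) \<and> (\<forall>t\<ge>0. 0 \<le> X t \<omega>) \<and> X 0 \<omega> = x"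

lemma AE_regular_path: "AE \<omega> in M. regular_path \<omega>"
proof -
  from solution obtain I where I: "has_ito_integral M F B (\<lambda>u \<omega>. sqrt (X u \<omega>)) I"
    and eq: "AE \<omega> in M. \<forall>t\<ge>0.
        X t \<omega> = x + 2 * I t \<omega> + integral {0..t} (\<lambda>u. \<Delta> u + 2 * \<theta> u * X u \<omega>)"
    and c: "AE \<omega> in M. continuous_on {0..} (\<lambda>t. X t \<omega>)" "AE \<omega> in M. \<forall>t\<ge>0. 0 \<le> X t \<omega>"
    unfolding gen_squared_bessel_II_def by blast
  from ito_integral_start[OF I] eq c show ?thesis
  proof eventually_elim
    case (elim \<omega>)
    then have "X 0 \<omega> = x" by (auto dest!: spec[of _ 0])
    with elim show ?case by (simp add: regular_path_def)
  qed
qed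

lemma regular_path_continuous:
  assumes "regular_path \<omega>" "0 \<le> s"
  shows "continuous_on {s..t} (\<lambda>u. X u \<omega>)"
  using assms by (auto simp: regular_path_def intro: continuous_on_subset)

lemma regular_path_nonneg: "regular_path \<omega> \<Longrightarrow> 0 \<le> t \<Longrightarrow> 0 \<le> X t \<omega>"
  by (auto simp: regular_path_def)

lemma continuous_coefficients:
  assumes "0 \<le> s"
  shows "continuous_on {s..t} \<Delta>" "continuous_on {s..t} \<theta>"
  using continuous_\<Delta> continuous_\<theta> assms by (auto intro: continuous_on_subset)

definition drift :: "real \<Rightarrow> 'a \<Rightarrow> real" where
  "drift u \<omega> = \<Delta> u + 2 * \<theta> u * X u \<omega>"

lemma continuous_drift:
  assumes "regular_path \<omega>" "0 \<le> s"
  shows "continuous_on {s..t} (\<lambda>u. drift u \<omega>)"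
  unfolding drift_def
  by (intro continuous_intros continuous_coefficients regular_path_continuous assms)

text \<open>The equation is solved for its martingale part \<open>2 * (I t - I s)\<close>. From here
  on the stochastic integral is expressed through \<open>X\<close> and ordinary path
  integrals.\<close>

lemma ito_limit_increment:
  assumes "0 \<le> s" "s \<le> t"
  shows "ito_limit M F B s t (\<lambda>\<omega>. X t \<omega> - X s \<omega> - integral {s..t} (\<lambda>u. drift u \<omega>))
    (\<lambda>\<omega>. 4 * integral {s..t} (\<lambda>u. X u \<omega>))"
proof -
  from solution obtain I where I: "has_ito_integral M F B (\<lambda>u \<omega>. sqrt (X u \<omega>)) I"
    and eq: "AE \<omega> in M. \<forall>t\<ge>0. X t \<omega> = x + 2 * I t \<omega> + integral {0..t} (\<lambda>u. drift u \<omega>)"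
    unfolding gen_squared_bessel_II_def drift_def by blast
  show ?thesis
  proof (rule ito_limit_cong_AE[OF ito_limit_cmult[OF ito_integral_imp_ito_limit[OF I assms], of 2]])
    show "AE \<omega> in M. 2 * (I t \<omega> - I s \<omega>) = X t \<omega> - X s \<omega> - integral {s..t} (\<lambda>u. drift u \<omega>) \<and>
        2\<^sup>2 * (\<integral>u. (indicator {s<..t} u * sqrt (X u \<omega>))\<^sup>2 \<partial>lborel) = 4 * integral {s..t} (\<lambda>u. X u \<omega>)"
      using eq AE_regular_path
    proof eventually_elim
      case (elim \<omega>)
      have "(\<integral>u. (indicator {s<..t} u * sqrt (X u \<omega>))\<^sup>2 \<partial>lborel) = integral {s..t} (\<lambda>u. X u \<omega>)"
        using assms elim(2) regular_path_nonneg
        by (intro integral_indicator_sqrt_square regular_path_continuous) auto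
      moreover have "integral {0..s} (\<lambda>u. drift u \<omega>) + integral {s..t} (\<lambda>u. drift u \<omega>) =
          integral {0..t} (\<lambda>u. drift u \<omega>)"
        using assms elim(2)
        by (intro Henstock_Kurzweil_Integration.integral_combine integrable_continuous_interval continuous_drift) auto
      moreover have "X t \<omega> = x + 2 * I t \<omega> + integral {0..t} (\<lambda>u. drift u \<omega>)"
          "X s \<omega> = x + 2 * I s \<omega> + integral {0..s} (\<lambda>u. drift u \<omega>)"
        using elim(1) assms by auto
      ultimately show ?case by simp
    qed
  qed
qed

text \<open>This takes the place of the product rule for \<open>g * X\<close>. Step functions of the
  deterministic \<open>g\<close> scale the increments of the martingale part, and summation by parts
  moves the differences from \<open>X\<close> to \<open>g\<close>, so that the limit exists path by
  path. No correction term appears because \<open>g\<close> has bounded variation.\<close>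

lemma ito_limit_integrate:
  assumes st: "0 \<le> s" "s \<le> t"
    and g: "\<And>u. u \<in> {s..t} \<Longrightarrow> (g has_real_derivative g' u) (at u within {s..t})"
    and g': "continuous_on {s..t} g'"
  shows "ito_limit M F B s t
    (\<lambda>\<omega>. g t * X t \<omega> - g s * X s \<omega> - integral {s..t} (\<lambda>u. X u \<omega> * g' u) - integral {s..t} (\<lambda>u. g u * drift u \<omega>))
    (\<lambda>\<omega>. 4 * integral {s..t} (\<lambda>u. (g u)\<^sup>2 * X u \<omega>))"
proof -
  define p where "p N j = s + real j * (t - s) / real (Suc N)" for N j
  have step: "p N (Suc j) = p N j + (t - s) / real (Suc N)" for N j
    by (simp add: p_def add_divide_distrib distrib_right)
  have p_le: "p N j \<le> p N (Suc j)" for N j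
    unfolding step using st by simp
  have p_ge: "s \<le> p N j" for N j using st by (simp add: p_def)
  have p_0: "p N 0 = s" for N by (simp add: p_def)
  have p_last: "p N (Suc N) = t" for N by (simp add: p_def)
  have p_upper: "p N j \<le> t" if "j \<le> Suc N" for N j
    using that lift_Suc_mono_le[of "p N", OF p_le that] p_last by simp
  have cg: "continuous_on {s..t} g"
    by (rule DERIV_continuous_on[OF g])
  define L where "L N \<omega> = (\<Sum>j<Suc N. g (p N j) * (X (p N (Suc j)) \<omega> - X (p N j) \<omega> -
    integral {p N j..p N (Suc j)} (\<lambda>u. drift u \<omega>)))" for N \<omega>
  define A where "A N \<omega> = (\<Sum>j<Suc N. (g (p N j))\<^sup>2 * (4 * integral {p N j..p N (Suc j)} (\<lambda>u. X u \<omega>)))" for N \<omega>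
  have "ito_limit M F B s (p N k)
      (\<lambda>\<omega>. \<Sum>j<k. g (p N j) * (X (p N (Suc j)) \<omega> - X (p N j) \<omega> - integral {p N j..p N (Suc j)} (\<lambda>u. drift u \<omega>)))
      (\<lambda>\<omega>. \<Sum>j<k. (g (p N j))\<^sup>2 * (4 * integral {p N j..p N (Suc j)} (\<lambda>u. X u \<omega>)))" for N k
  proof (induction k)
    case 0
    show ?case using ito_limit_start by (simp add: p_0)
  next
    case (Suc k)
    have "0 \<le> p N k" using p_ge[of N k] st by linarith
    from ito_limit_trans[OF Suc ito_limit_cmult[OF ito_limit_increment[OF this p_le]]]
    show ?case by simp
  qed
  from this[of N "Suc N" for N] have "ito_limit M F B s t (L N) (A N)" for N
    unfolding p_last L_def[abs_def] A_def[abs_def] .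
  then show ?thesis
  proof (rule ito_limit_closed[OF _ st(1)])
    show "AE \<omega> in M. (\<lambda>N. L N \<omega>) \<longlonglongrightarrow> g t * X t \<omega> - g s * X s \<omega> -
        integral {s..t} (\<lambda>u. X u \<omega> * g' u) - integral {s..t} (\<lambda>u. g u * drift u \<omega>) \<and>
      (\<lambda>N. A N \<omega>) \<longlonglongrightarrow> 4 * integral {s..t} (\<lambda>u. (g u)\<^sup>2 * X u \<omega>)"
      using AE_regular_path
    proof eventually_elim
      case (elim \<omega>)
      note cX = regular_path_continuous[OF elim st(1), of t]
      \<comment> \<open>Abel summation: \<open>g\<close> at left end points leaves \<open>X\<close>
        at right end points, and each difference of \<open>g\<close> is written as an integral of
        \<open>g'\<close>.\<close>
      have by_parts: "(\<Sum>j<k. g (p N j) * (X (p N (Suc j)) \<omega> - X (p N j) \<omega>)) =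
          g (p N k) * X (p N k) \<omega> - g s * X s \<omega> -
          (\<Sum>j<k. X (p N (Suc j)) \<omega> * integral {p N j..p N (Suc j)} g')" if "k \<le> Suc N" for N k
        using that
      proof (induction k)
        case 0
        show ?case by (simp add: p_0)
      next
        case (Suc k)
        have sub: "{p N k..p N (Suc k)} \<subseteq> {s..t}" using p_ge p_upper[OF Suc.prems] by auto
        have "(g' has_integral g (p N (Suc k)) - g (p N k)) {p N k..p N (Suc k)}"
          by (intro fundamental_theorem_of_calculus p_le)
            (use sub in \<open>auto simp: has_real_derivative_iff_has_vector_derivative[symmetric] intro!: DERIV_subset[OF g sub]\<close>)
        then have g'_integral: "integral {p N k..p N (Suc k)} g' = g (p N (Suc k)) - g (p N k)"
          by (rule integral_unique)
        show ?case
          unfolding sum.lessThan_Suc Suc.IH[OF Suc_leD[OF Suc.prems]] g'_integral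
          by (simp add: algebra_simps)
      qed
      have L: "L N \<omega> = g t * X t \<omega> - g s * X s \<omega> -
          (\<Sum>j<Suc N. X (p N (Suc j)) \<omega> * integral {p N j..p N (Suc j)} g') -
          (\<Sum>j<Suc N. g (p N j) * integral {p N j..p N (Suc j)} (\<lambda>u. drift u \<omega>))" for N
        using by_parts[of "Suc N" N] unfolding L_def p_last
        by (simp only: right_diff_distrib[of "g (p N j)" for j] sum_subtractf)
      have "(\<lambda>N. \<Sum>j<Suc N. X (p N (Suc j)) \<omega> * integral {p N j..p N (Suc j)} g') \<longlonglongrightarrow>
          integral {s..t} (\<lambda>u. X u \<omega> * g' u)"
        using riemann_sum_tendsto[OF p_def st(2) cX g', of "\<lambda>N j. p N (Suc j)"] p_le by simp
      moreover have "(\<lambda>N. \<Sum>j<Suc N. g (p N j) * integral {p N j..p N (Suc j)} (\<lambda>u. drift u \<omega>)) \<longlonglongrightarrow>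
          integral {s..t} (\<lambda>u. g u * drift u \<omega>)"
        using riemann_sum_tendsto[OF p_def st(2) cg continuous_drift[OF elim st(1)], of "\<lambda>N j. p N j"] p_le by simp
      ultimately have "(\<lambda>N. L N \<omega>) \<longlonglongrightarrow> g t * X t \<omega> - g s * X s \<omega> -
          integral {s..t} (\<lambda>u. X u \<omega> * g' u) - integral {s..t} (\<lambda>u. g u * drift u \<omega>)"
        unfolding L by (intro tendsto_diff tendsto_const)
      moreover have "(\<lambda>N. \<Sum>j<Suc N. (g (p N j))\<^sup>2 * integral {p N j..p N (Suc j)} (\<lambda>u. X u \<omega>)) \<longlonglongrightarrow>
          integral {s..t} (\<lambda>u. (g u)\<^sup>2 * X u \<omega>)"
        using riemann_sum_tendsto[OF p_def st(2) continuous_on_power[OF cg, of 2] cX, of "\<lambda>N j. p N j"] p_le by simp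
      then have "(\<lambda>N. 4 * (\<Sum>j<Suc N. (g (p N j))\<^sup>2 * integral {p N j..p N (Suc j)} (\<lambda>u. X u \<omega>))) \<longlonglongrightarrow>
          4 * integral {s..t} (\<lambda>u. (g u)\<^sup>2 * X u \<omega>)"
        by (intro tendsto_mult_left)
      moreover have "A N \<omega> = 4 * (\<Sum>j<Suc N. (g (p N j))\<^sup>2 * integral {p N j..p N (Suc j)} (\<lambda>u. X u \<omega>))" for N
        unfolding A_def sum_distrib_left by (simp add: mult_ac)
      ultimately show ?case by simp
    qed
  qed
qed

end

section \<open>The Laplace transform\<close>

context squared_bessel
begin

text \<open>By \<open>ito_limit_integrate\<close>, the left exponent is that of the right side plus
  \<open>L - A / 2\<close> and the integral of
  \<open>X * (g' + 2 * g^2 + q) + 2 * \<theta> * g * X\<close>. The first term of this integrand is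
  nonpositive by the Riccati inequality, the second by the signs of \<open>\<theta>\<close>,
  \<open>g\<close> and \<open>X\<close>. The Fatou bound does the rest.\<close>

lemma exponential_moment_le:
  assumes st: "0 \<le> s" "s \<le> t" and "0 \<le> q"
    and g: "\<And>u. u \<in> {s..t} \<Longrightarrow> (g has_real_derivative g' u) (at u within {s..t})"
    and g': "continuous_on {s..t} g'"
    and g_nonneg: "\<And>u. u \<in> {s..t} \<Longrightarrow> 0 \<le> g u"
    and riccati: "\<And>u. u \<in> {s..t} \<Longrightarrow> g' u + 2 * (g u)\<^sup>2 + q \<le> 0"
  shows "(\<integral>\<^sup>+\<omega>. ennreal (exp (g t * X t \<omega> + q * integral {s..t} (\<lambda>u. X u \<omega>))) \<partial>M) \<le>
    ennreal (exp (integral {s..t} (\<lambda>u. g u * \<Delta> u))) * (\<integral>\<^sup>+\<omega>. ennreal (exp (g s * X s \<omega>)) \<partial>M)"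
proof -
  define L where "L \<omega> = g t * X t \<omega> - g s * X s \<omega> - integral {s..t} (\<lambda>u. X u \<omega> * g' u) -
    integral {s..t} (\<lambda>u. g u * drift u \<omega>)" for \<omega>
  define A where "A \<omega> = 4 * integral {s..t} (\<lambda>u. (g u)\<^sup>2 * X u \<omega>)" for \<omega>
  let ?c = "integral {s..t} (\<lambda>u. g u * \<Delta> u)"
  have cg: "continuous_on {s..t} g" by (rule DERIV_continuous_on[OF g])
  have [measurable]: "X s \<in> borel_measurable (F s)" "X s \<in> borel_measurable M"
    using X_adapted X_measurable st by auto
  have IL: "ito_limit M F B s t L A"
    unfolding L_def[abs_def] A_def[abs_def] by (rule ito_limit_integrate[OF st g g'])
  have "(\<integral>\<^sup>+\<omega>. ennreal (exp (g t * X t \<omega> + q * integral {s..t} (\<lambda>u. X u \<omega>))) \<partial>M) \<le>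
      (\<integral>\<^sup>+\<omega>. ennreal (exp ?c * exp (g s * X s \<omega>) * exp (L \<omega> - A \<omega> / 2)) \<partial>M)"
  proof (rule nn_integral_mono_AE)
    show "AE \<omega> in M. ennreal (exp (g t * X t \<omega> + q * integral {s..t} (\<lambda>u. X u \<omega>))) \<le>
        ennreal (exp ?c * exp (g s * X s \<omega>) * exp (L \<omega> - A \<omega> / 2))"
      using AE_regular_path
    proof eventually_elim
      case (elim \<omega>)
      note c = cg g' regular_path_continuous[OF elim st(1), of t] continuous_drift[OF elim st(1), of t]
        continuous_coefficients[OF st(1), of t]
      have "((\<lambda>u. X u \<omega> * g' u + g u * drift u \<omega> + 2 * ((g u)\<^sup>2 * X u \<omega>) + q * X u \<omega> - g u * \<Delta> u) has_integral
          integral {s..t} (\<lambda>u. X u \<omega> * g' u) + integral {s..t} (\<lambda>u. g u * drift u \<omega>) +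
          2 * integral {s..t} (\<lambda>u. (g u)\<^sup>2 * X u \<omega>) + q * integral {s..t} (\<lambda>u. X u \<omega>) - ?c) {s..t}"
        by (intro has_integral_add has_integral_diff has_integral_mult_right integrable_integral
            integrable_continuous_interval continuous_intros c)
      moreover have "X u \<omega> * g' u + g u * drift u \<omega> + 2 * ((g u)\<^sup>2 * X u \<omega>) + q * X u \<omega> - g u * \<Delta> u \<le> 0"
        if u: "u \<in> {s..t}" for u
      proof -
        have "X u \<omega> * g' u + g u * drift u \<omega> + 2 * ((g u)\<^sup>2 * X u \<omega>) + q * X u \<omega> - g u * \<Delta> u =
            X u \<omega> * (g' u + 2 * (g u)\<^sup>2 + q) + 2 * (g u * X u \<omega>) * \<theta> u"
          by (simp add: drift_def algebra_simps)
        moreover have "0 \<le> X u \<omega>" "\<theta> u \<le> 0"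
          using regular_path_nonneg[OF elim, of u] \<theta>_nonpos[of u] u st by auto
        then have "X u \<omega> * (g' u + 2 * (g u)\<^sup>2 + q) \<le> 0" "2 * (g u * X u \<omega>) * \<theta> u \<le> 0"
          using riccati[OF u] g_nonneg[OF u]
          by (intro mult_nonneg_nonpos mult_nonneg_nonneg; simp)+
        ultimately show ?thesis by linarith
      qed
      ultimately have "integral {s..t} (\<lambda>u. X u \<omega> * g' u) + integral {s..t} (\<lambda>u. g u * drift u \<omega>) +
          2 * integral {s..t} (\<lambda>u. (g u)\<^sup>2 * X u \<omega>) + q * integral {s..t} (\<lambda>u. X u \<omega>) - ?c \<le> 0"
        by (rule has_integral_le[OF _ has_integral_0])
      then have "g t * X t \<omega> + q * integral {s..t} (\<lambda>u. X u \<omega>) \<le> ?c + g s * X s \<omega> + (L \<omega> - A \<omega> / 2)"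
        by (simp add: L_def A_def)
      then have "exp (g t * X t \<omega> + q * integral {s..t} (\<lambda>u. X u \<omega>)) \<le> exp (?c + g s * X s \<omega> + (L \<omega> - A \<omega> / 2))"
        by simp
      then show ?case by (intro ennreal_leI) (simp only: exp_add)
    qed
  qed
  also have "\<dots> \<le> (\<integral>\<^sup>+\<omega>. ennreal (exp ?c * exp (g s * X s \<omega>)) \<partial>M)"
    by (rule ito_limit_exponential_le[OF IL st(1)]) measurable
  also have "\<dots> = ennreal (exp ?c) * (\<integral>\<^sup>+\<omega>. ennreal (exp (g s * X s \<omega>)) \<partial>M)"
    by (simp add: ennreal_mult' nn_integral_cmult)
  finally show ?thesis .
qed

text \<open>The function \<open>1 / (1 + 2 * u)\<close> solves \<open>g' = - 2 * g^2\<close> with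
  \<open>g 0 = 1\<close>, and at time 0 the moment is simply \<open>exp x\<close>. The rate
  \<open>1 / (1 + 2 * T)\<close> lies below \<open>g s\<close> for all \<open>s\<close> up to
  \<open>T\<close>, so one rate serves all starting times of the short intervals.\<close>

lemma exponential_moment_finite:
  assumes "0 \<le> s" "s \<le> T"
  shows "(\<integral>\<^sup>+\<omega>. ennreal (exp (X s \<omega> / (1 + 2 * T))) \<partial>M) < \<infinity>"
proof -
  define g where "g u = 1 / (1 + 2 * u)" for u :: real
  define g' where "g' u = - 2 / (1 + 2 * u)\<^sup>2" for u :: real
  have "(\<integral>\<^sup>+\<omega>. ennreal (exp (X s \<omega> / (1 + 2 * T))) \<partial>M) \<le>
      (\<integral>\<^sup>+\<omega>. ennreal (exp (g s * X s \<omega> + 0 * integral {0..s} (\<lambda>u. X u \<omega>))) \<partial>M)"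
  proof (rule nn_integral_mono_AE)
    show "AE \<omega> in M. ennreal (exp (X s \<omega> / (1 + 2 * T))) \<le>
        ennreal (exp (g s * X s \<omega> + 0 * integral {0..s} (\<lambda>u. X u \<omega>)))"
      using AE_regular_path
      by eventually_elim
        (use assms regular_path_nonneg in \<open>auto intro!: ennreal_leI divide_left_mono simp: g_def\<close>)
  qed
  also have "\<dots> \<le> ennreal (exp (integral {0..s} (\<lambda>u. g u * \<Delta> u))) * (\<integral>\<^sup>+\<omega>. ennreal (exp (g 0 * X 0 \<omega>)) \<partial>M)"
  proof (rule exponential_moment_le[where g' = g'])
    show "(g has_real_derivative g' u) (at u within {0..s})" if "u \<in> {0..s}" for u
      unfolding g_def[abs_def] g'_def using that
      by (auto intro!: derivative_eq_intros simp: power2_eq_square)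
    show "continuous_on {0..s} g'"
      unfolding g'_def by (intro continuous_intros) auto
    show "g' u + 2 * (g u)\<^sup>2 + 0 \<le> 0" if "u \<in> {0..s}" for u
      by (simp add: g_def g'_def power_divide)
  qed (use assms in \<open>auto simp: g_def\<close>)
  also have "(\<integral>\<^sup>+\<omega>. ennreal (exp (g 0 * X 0 \<omega>)) \<partial>M) = (\<integral>\<^sup>+\<omega>. ennreal (exp x) \<partial>M)"
  proof (rule nn_integral_cong_AE)
    show "AE \<omega> in M. ennreal (exp (g 0 * X 0 \<omega>)) = ennreal (exp x)"
      using AE_regular_path by eventually_elim (simp add: regular_path_def g_def)
  qed
  also have "ennreal (exp (integral {0..s} (\<lambda>u. g u * \<Delta> u))) * (\<integral>\<^sup>+\<omega>. ennreal (exp x) \<partial>M) < \<infinity>"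
    by (simp add: emeasure_space_1 ennreal_mult'[symmetric])
  finally show ?thesis .
qed

text \<open>
  On a short interval the linear function \<open>a - (2 * a\<^sup>2 + q) * (u - s)\<close> stays nonnegative and satisfies
  the Riccati inequality of \<open>exponential_moment_le\<close>.
\<close>

lemma integrated_exponential_moment_finite:
  assumes st: "0 \<le> s" "s \<le> t" "t \<le> T" and q: "0 \<le> q"
    and short: "(t - s) * (2 * (1 / (1 + 2 * T))\<^sup>2 + q) \<le> 1 / (1 + 2 * T)"
  shows "(\<integral>\<^sup>+\<omega>. ennreal (exp (q * integral {s..t} (\<lambda>u. X u \<omega>))) \<partial>M) < \<infinity>"
proof -
  define a where "a = 1 / (1 + 2 * T)"
  define b where "b = 2 * a\<^sup>2 + q"
  define g where "g u = a - (u - s) * b" for u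
  have a: "0 < a" using st by (simp add: a_def)
  have b: "0 \<le> b" using q by (simp add: b_def)
  have g_nonneg: "0 \<le> g u" if "u \<in> {s..t}" for u
  proof -
    have "(u - s) * b \<le> (t - s) * b" using that b by (intro mult_right_mono) auto
    also have "\<dots> \<le> a" using short by (simp add: a_def b_def)
    finally show ?thesis by (simp add: g_def)
  qed
  have g_le: "g u \<le> a" if "u \<in> {s..t}" for u using that b by (simp add: g_def)
  have "(\<integral>\<^sup>+\<omega>. ennreal (exp (q * integral {s..t} (\<lambda>u. X u \<omega>))) \<partial>M) \<le>
      (\<integral>\<^sup>+\<omega>. ennreal (exp (g t * X t \<omega> + q * integral {s..t} (\<lambda>u. X u \<omega>))) \<partial>M)"
  proof (rule nn_integral_mono_AE)
    show "AE \<omega> in M. ennreal (exp (q * integral {s..t} (\<lambda>u. X u \<omega>))) \<le>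
        ennreal (exp (g t * X t \<omega> + q * integral {s..t} (\<lambda>u. X u \<omega>)))"
      using AE_regular_path
      by eventually_elim (use st g_nonneg[of t] regular_path_nonneg in \<open>auto intro!: ennreal_leI\<close>)
  qed
  also have "\<dots> \<le> ennreal (exp (integral {s..t} (\<lambda>u. g u * \<Delta> u))) * (\<integral>\<^sup>+\<omega>. ennreal (exp (g s * X s \<omega>)) \<partial>M)"
  proof (rule exponential_moment_le[where g' = "\<lambda>_. - b"])
    show "(g has_real_derivative - b) (at u within {s..t})" for u
      unfolding g_def[abs_def] by (auto intro!: derivative_eq_intros)
    show "- b + 2 * (g u)\<^sup>2 + q \<le> 0" if "u \<in> {s..t}" for u
      using power_mono[OF g_le[OF that] g_nonneg[OF that], of 2] by (simp add: b_def)
  qed (use st q g_nonneg in auto)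
  also have "(\<integral>\<^sup>+\<omega>. ennreal (exp (g s * X s \<omega>)) \<partial>M) < \<infinity>"
    using exponential_moment_finite[of s T] st by (simp add: g_def a_def)
  then have "ennreal (exp (integral {s..t} (\<lambda>u. g u * \<Delta> u))) * (\<integral>\<^sup>+\<omega>. ennreal (exp (g s * X s \<omega>)) \<partial>M) < \<infinity>"
    by (simp add: ennreal_mult_less_top)
  finally show ?thesis .
qed

text \<open>The equality criterion is applied with \<open>g = - f\<close>. The Riccati equation
  removes every term in \<open>X\<close> from the time integrals and leaves the integral of
  \<open>f * \<Delta>\<close>, which is deterministic and leaves the expectation as a
  factor.\<close>

lemma laplace_step:
  assumes st: "0 \<le> s" "s \<le> t" "t \<le> T"
    and f: "\<And>u. u \<in> {s..t} \<Longrightarrow> (f has_real_derivative 2 * (f u)\<^sup>2 - 2 * \<theta> u * f u) (at u within {s..t})"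
    and bound: "\<And>u. u \<in> {s..t} \<Longrightarrow> 0 \<le> f u \<and> f u \<le> G"
    and short: "(t - s) * (2 * (1 / (1 + 2 * T))\<^sup>2 + 12 * G\<^sup>2) \<le> 1 / (1 + 2 * T)"
  shows "ennreal (exp (integral {s..t} (\<lambda>u. f u * \<Delta> u))) * (\<integral>\<^sup>+\<omega>. ennreal (exp (- f t * X t \<omega>)) \<partial>M) =
    (\<integral>\<^sup>+\<omega>. ennreal (exp (- f s * X s \<omega>)) \<partial>M)"
proof -
  define f' where "f' u = 2 * (f u)\<^sup>2 - 2 * \<theta> u * f u" for u
  have cf: "continuous_on {s..t} f" by (rule DERIV_continuous_on[OF f])
  have cf': "continuous_on {s..t} f'"
    unfolding f'_def by (intro continuous_intros cf continuous_coefficients st)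
  have g: "((\<lambda>u. - f u) has_real_derivative - f' u) (at u within {s..t})" if "u \<in> {s..t}" for u
    using DERIV_minus[OF f[OF that]] by (simp add: f'_def)
  define L where "L \<omega> = - f t * X t \<omega> - - f s * X s \<omega> - integral {s..t} (\<lambda>u. X u \<omega> * - f' u) -
    integral {s..t} (\<lambda>u. - f u * drift u \<omega>)" for \<omega>
  define A where "A \<omega> = 4 * integral {s..t} (\<lambda>u. (- f u)\<^sup>2 * X u \<omega>)" for \<omega>
  let ?c = "integral {s..t} (\<lambda>u. f u * \<Delta> u)"
  have [measurable]: "X s \<in> borel_measurable (F s)" "X t \<in> borel_measurable M"
    using X_adapted X_measurable st by auto
  have IL: "ito_limit M F B s t L A"
    unfolding L_def[abs_def] A_def[abs_def]
    by (rule ito_limit_integrate[OF st(1,2) g]) (auto intro: continuous_on_minus cf')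
  \<comment> \<open>The equality criterion wants a weight bounded by 1 everywhere, whereas
    \<open>X\<close> is nonnegative only almost surely; hence the cap.\<close>
  define y where "y \<omega> = min 1 (exp (- f s * X s \<omega>))" for \<omega>
  have ym: "y \<in> borel_measurable (F s)" unfolding y_def[abs_def] by measurable
  have y_eq: "y \<omega> = exp (- f s * X s \<omega>)" if "regular_path \<omega>" for \<omega>
  proof -
    have "0 \<le> f s * X s \<omega>"
      using bound[of s] regular_path_nonneg[OF that st(1)] st by (intro mult_nonneg_nonneg) auto
    then show ?thesis by (simp add: y_def min_absorb2)
  qed
  have fin: "(\<integral>\<^sup>+\<omega>. ennreal (exp (3 * A \<omega>)) \<partial>M) < \<infinity>"
  proof -
    \<comment> \<open>The constant 12 is the 3 of the criterion times the 4 in the bracket.\<close>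
    have "(\<integral>\<^sup>+\<omega>. ennreal (exp (3 * A \<omega>)) \<partial>M) \<le>
        (\<integral>\<^sup>+\<omega>. ennreal (exp (12 * G\<^sup>2 * integral {s..t} (\<lambda>u. X u \<omega>))) \<partial>M)"
    proof (rule nn_integral_mono_AE)
      show "AE \<omega> in M. ennreal (exp (3 * A \<omega>)) \<le> ennreal (exp (12 * G\<^sup>2 * integral {s..t} (\<lambda>u. X u \<omega>)))"
        using AE_regular_path
      proof eventually_elim
        case (elim \<omega>)
        have "integral {s..t} (\<lambda>u. (- f u)\<^sup>2 * X u \<omega>) \<le> integral {s..t} (\<lambda>u. G\<^sup>2 * X u \<omega>)"
        proof (rule integral_le)
          show "(- f u)\<^sup>2 * X u \<omega> \<le> G\<^sup>2 * X u \<omega>" if "u \<in> {s..t}" for u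
            using bound[OF that] regular_path_nonneg[OF elim, of u] that st
            by (intro mult_right_mono) (auto intro: power_mono)
        qed (intro integrable_continuous_interval continuous_intros cf regular_path_continuous elim st)+
        then show ?case by (auto simp: A_def intro!: ennreal_leI)
      qed
    qed
    also have "\<dots> < \<infinity>"
      by (rule integrated_exponential_moment_finite[OF st _ short]) simp
    finally show ?thesis .
  qed
  have "(\<integral>\<^sup>+\<omega>. ennreal (exp (- f s * X s \<omega>)) \<partial>M) = (\<integral>\<^sup>+\<omega>. ennreal (y \<omega>) \<partial>M)"
    by (rule nn_integral_cong_AE) (use AE_regular_path in eventually_elim, simp add: y_eq)
  also have "\<dots> = (\<integral>\<^sup>+\<omega>. ennreal (y \<omega> * exp (L \<omega> - A \<omega> / 2)) \<partial>M)"
    by (rule ito_limit_exponential_eq[OF IL st(1) ym _ _ fin, symmetric]) (auto simp: y_def)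
  also have "\<dots> = (\<integral>\<^sup>+\<omega>. ennreal (exp ?c) * ennreal (exp (- f t * X t \<omega>)) \<partial>M)"
  proof (rule nn_integral_cong_AE)
    show "AE \<omega> in M. ennreal (y \<omega> * exp (L \<omega> - A \<omega> / 2)) = ennreal (exp ?c) * ennreal (exp (- f t * X t \<omega>))"
      using AE_regular_path
    proof eventually_elim
      case (elim \<omega>)
      note c = cf cf' regular_path_continuous[OF elim st(1), of t] continuous_drift[OF elim st(1), of t]
        continuous_coefficients[OF st(1), of t]
      have "((\<lambda>u. - (X u \<omega> * - f' u) - - f u * drift u \<omega> - 2 * ((- f u)\<^sup>2 * X u \<omega>)) has_integral
          - integral {s..t} (\<lambda>u. X u \<omega> * - f' u) - integral {s..t} (\<lambda>u. - f u * drift u \<omega>) -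
          2 * integral {s..t} (\<lambda>u. (- f u)\<^sup>2 * X u \<omega>)) {s..t}"
        by (intro has_integral_diff has_integral_neg has_integral_mult_right integrable_integral
            integrable_continuous_interval continuous_intros c)
      \<comment> \<open>The Riccati equation is used here: all terms in \<open>X u\<close>
        cancel.\<close>
      moreover have "- (X u \<omega> * - f' u) - - f u * drift u \<omega> - 2 * ((- f u)\<^sup>2 * X u \<omega>) = f u * \<Delta> u" for u
        by (simp add: drift_def f'_def power2_eq_square algebra_simps)
      ultimately have "?c = - integral {s..t} (\<lambda>u. X u \<omega> * - f' u) - integral {s..t} (\<lambda>u. - f u * drift u \<omega>) -
          2 * integral {s..t} (\<lambda>u. (- f u)\<^sup>2 * X u \<omega>)"
        by (simp add: integral_unique)
      then have "- f s * X s \<omega> + (L \<omega> - A \<omega> / 2) = ?c + - f t * X t \<omega>"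
        by (simp add: L_def A_def)
      then have "y \<omega> * exp (L \<omega> - A \<omega> / 2) = exp ?c * exp (- f t * X t \<omega>)"
        by (simp only: y_eq[OF elim] exp_add[symmetric])
      then show ?case by (simp add: ennreal_mult')
    qed
  qed
  also have "\<dots> = ennreal (exp ?c) * (\<integral>\<^sup>+\<omega>. ennreal (exp (- f t * X t \<omega>)) \<partial>M)"
    by (rule nn_integral_cmult) measurable
  finally show ?thesis by simp
qed

text \<open>The quantity \<open>\<Phi>\<close>, the discounted Laplace transform along
  \<open>f\<close>, is constant on each short interval. The admissible length depends only on
  \<open>T\<close> and a bound for \<open>f\<close>, so finitely many steps lead from
  \<open>T\<close> back to 0.\<close>

lemma laplace_transform:
  assumes T: "0 \<le> T"
    and f: "\<And>u. u \<in> {0..T} \<Longrightarrow> (f has_real_derivative 2 * (f u)\<^sup>2 - 2 * \<theta> u * f u) (at u within {0..T})"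
    and f_nonneg: "\<And>u. u \<in> {0..T} \<Longrightarrow> 0 \<le> f u"
  shows "(\<integral>\<^sup>+\<omega>. ennreal (exp (- f T * X T \<omega>)) \<partial>M) =
    ennreal (exp (- x * f 0 - integral {0..T} (\<lambda>u. f u * \<Delta> u)))"
proof -
  have cf: "continuous_on {0..T} f" by (rule DERIV_continuous_on[OF f])
  have cfd: "continuous_on {0..T} (\<lambda>u. f u * \<Delta> u)"
    by (intro continuous_intros cf continuous_coefficients) simp
  obtain G where G: "0 < G" "\<And>u. u \<in> {0..T} \<Longrightarrow> \<bar>f u\<bar> \<le> G"
    using continuous_on_bounded_real[OF cf] by metis
  define b where "b = 2 * (1 / (1 + 2 * T))\<^sup>2 + 12 * G\<^sup>2"
  have b: "0 < b" using G by (simp add: b_def add_nonneg_pos)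
  \<comment> \<open>The largest length allowed by the smallness condition of
    \<open>laplace_step\<close>.\<close>
  define h where "h = 1 / (1 + 2 * T) / b"
  have h: "0 < h" using b T by (simp add: h_def)
  define \<Phi> where "\<Phi> s = ennreal (exp (integral {0..s} (\<lambda>u. f u * \<Delta> u))) *
    (\<integral>\<^sup>+\<omega>. ennreal (exp (- f s * X s \<omega>)) \<partial>M)" for s
  have step: "\<Phi> t = \<Phi> s" if st: "0 \<le> s" "s \<le> t" "t \<le> T" "t - s \<le> h" for s t
  proof -
    have sub: "{s..t} \<subseteq> {0..T}" using st by auto
    have "(t - s) * b \<le> h * b" using st b by (intro mult_right_mono) auto
    then have short: "(t - s) * b \<le> 1 / (1 + 2 * T)" using b by (simp add: h_def)
    have comb: "integral {0..s} (\<lambda>u. f u * \<Delta> u) + integral {s..t} (\<lambda>u. f u * \<Delta> u) = integral {0..t} (\<lambda>u. f u * \<Delta> u)"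
      using st by (intro Henstock_Kurzweil_Integration.integral_combine integrable_continuous_interval
          continuous_on_subset[OF cfd]) auto
    have "\<Phi> t = ennreal (exp (integral {0..s} (\<lambda>u. f u * \<Delta> u))) *
        (ennreal (exp (integral {s..t} (\<lambda>u. f u * \<Delta> u))) * (\<integral>\<^sup>+\<omega>. ennreal (exp (- f t * X t \<omega>)) \<partial>M))"
      by (simp only: \<Phi>_def comb[symmetric] exp_add ennreal_mult' exp_ge_zero mult.assoc)
    also have "\<dots> = \<Phi> s"
      unfolding \<Phi>_def
      by (subst laplace_step[of s t T f G])
        (use st sub short G(2) f_nonneg in \<open>auto simp: b_def abs_le_iff intro: DERIV_subset[OF f]\<close>)
    finally show ?thesis .
  qed
  have "\<Phi> s = \<Phi> 0" if "0 \<le> s" "s \<le> T" "s \<le> real n * h" for s n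
    using that
  proof (induction n arbitrary: s)
    case 0
    then show ?case by simp
  next
    case (Suc n)
    \<comment> \<open>One step back from \<open>s\<close>, cut off at time 0.\<close>
    have "\<Phi> s = \<Phi> (max 0 (s - h))" using Suc.prems h by (intro step) auto
    also have "\<dots> = \<Phi> 0" using Suc.prems h by (intro Suc.IH) (auto simp: algebra_simps)
    finally show ?case .
  qed
  moreover obtain n where "T \<le> real n * h" using reals_Archimedean3[OF h] by (metis less_imp_le)
  ultimately have "\<Phi> T = \<Phi> 0" using T by blast
  also have "\<Phi> 0 = (\<integral>\<^sup>+\<omega>. ennreal (exp (- f 0 * X 0 \<omega>)) \<partial>M)" by (simp add: \<Phi>_def)
  also have "\<dots> = (\<integral>\<^sup>+\<omega>. ennreal (exp (- f 0 * x)) \<partial>M)"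
    by (rule nn_integral_cong_AE) (use AE_regular_path in eventually_elim, simp add: regular_path_def)
  also have "\<dots> = ennreal (exp (- x * f 0))" by (simp add: emeasure_space_1 mult.commute)
  finally have *: "\<Phi> T = ennreal (exp (- x * f 0))" .
  let ?c = "integral {0..T} (\<lambda>u. f u * \<Delta> u)"
  have "(\<integral>\<^sup>+\<omega>. ennreal (exp (- f T * X T \<omega>)) \<partial>M) = ennreal (exp (- ?c)) * \<Phi> T"
    by (simp add: \<Phi>_def mult.assoc[symmetric] ennreal_mult'[symmetric] exp_add[symmetric])
  also have "\<dots> = ennreal (exp (- x * f 0 - ?c))"
    unfolding * by (simp add: ennreal_mult'[symmetric] exp_add[symmetric])
  finally show ?thesis .
qed

end

section \<open>The explicit Riccati solution and the Laplace transform\<close>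

theorem proposition2p12:
  fixes M :: "'a measure" and F :: "real \<Rightarrow> 'a measure"
    and B X :: "real \<Rightarrow> 'a \<Rightarrow> real"
    and \<Delta> \<theta> :: "real \<Rightarrow> real" and x l t :: real
  assumes "brownian_motion M F B"
    and "continuous_on {0..} \<Delta>" and "\<forall>u\<ge>0. 0 \<le> \<Delta> u"
    and "continuous_on {0..} \<theta>" and "\<forall>u\<ge>0. \<theta> u \<le> 0"
    and "0 \<le> x"
    and "gen_squared_bessel_II M F B \<Delta> \<theta> x X"
    and "0 \<le> l" and "0 \<le> t"
  shows "prob_space.expectation M (\<lambda>\<omega>. exp (- l * X t \<omega>)) =
    exp (- x * bessel_phi \<theta> t l - bessel_psi \<Delta> \<theta> t l)"
proof -
  interpret brownian_motion M F B by fact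
  interpret squared_bessel M F B \<Delta> \<theta> x X
    by unfold_locales (use assms in auto)
  define k where "k = bessel_k \<theta>"
  define K where "K u = integral {0..u} k" for u
  define z where "z = bessel_phi \<theta> t l"
  \<comment> \<open>In terms of the linear equation for \<open>1 / f\<close>, \<open>k / f\<close>
    has derivative \<open>- 2 * k\<close>, so \<open>k / f = 1 / z - 2 * K\<close> for nonzero
    \<open>z\<close>. The value \<open>z = f 0\<close> is fixed by the terminal condition
    \<open>f t = l\<close>.\<close>
  define f where "f u = z * (k u / (1 - 2 * z * K u))" for u
  have k_pos: "0 < k u" for u by (simp add: k_def bessel_k_def)
  have k: "(k has_real_derivative - 2 * \<theta> u * k u) (at u within {0..t})" if "u \<in> {0..t}" for u
  proof -
    have "((\<lambda>u. integral {0..u} \<theta>) has_real_derivative \<theta> u) (at u within {0..t})"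
      using that by (intro integral_has_real_derivative continuous_coefficients) auto
    then show ?thesis
      unfolding k_def bessel_k_def[abs_def] by (auto intro!: derivative_eq_intros)
  qed
  have ck: "continuous_on {0..t} k" by (rule DERIV_continuous_on[OF k])
  have K: "(K has_real_derivative k u) (at u within {0..t})" if "u \<in> {0..t}" for u
    unfolding K_def[abs_def] using that by (intro integral_has_real_derivative ck) auto
  have K_nonneg: "0 \<le> K u" if "u \<in> {0..t}" for u
    unfolding K_def using that k_pos
    by (intro integral_nonneg integrable_continuous_interval continuous_on_subset[OF ck]) (auto intro: less_imp_le)
  have K_le: "K u \<le> K t" if "u \<in> {0..t}" for u
    unfolding K_def using that k_pos
    by (intro integral_subset_le integrable_continuous_interval continuous_on_subset[OF ck]) (auto intro: less_imp_le)
  define d where "d = k t + 2 * l * K t"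
  have d: "0 < d" using k_pos[of t] K_nonneg[of t] assms(8,9) by (simp add: d_def add_pos_nonneg)
  have z: "z = l / d" by (simp add: z_def bessel_phi_def d_def k_def K_def)
  \<comment> \<open>The Riccati solution does not blow up before \<open>t\<close>: \<open>K\<close>
    is increasing, and at time \<open>t\<close> the denominator is still
    \<open>k t / d\<close>.\<close>
  have denom_pos: "0 < 1 - 2 * z * K u" if "u \<in> {0..t}" for u
  proof -
    have "2 * l * K u \<le> 2 * l * K t" using K_le[OF that] assms(8) by (intro mult_left_mono) auto
    then have "2 * l * K u < d" using k_pos[of t] by (simp add: d_def)
    then show ?thesis using d by (simp add: z field_simps)
  qed
  have z_nonneg: "0 \<le> z" using d assms(8) by (simp add: z)
  have f: "(f has_real_derivative 2 * (f u)\<^sup>2 - 2 * \<theta> u * f u) (at u within {0..t})" if u: "u \<in> {0..t}" for u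
  proof -
    have ne: "1 - 2 * z * K u \<noteq> 0" using denom_pos[OF u] by simp
    show ?thesis
      unfolding f_def[abs_def] using ne
      by (auto intro!: derivative_eq_intros k[OF u] K[OF u] simp: divide_simps power2_eq_square)
  qed
  have f_nonneg: "0 \<le> f u" if "u \<in> {0..t}" for u
    using denom_pos[OF that] k_pos[of u] z_nonneg by (simp add: f_def)
  have f_t: "f t = l"
  proof -
    have "1 - 2 * z * K t = k t / d" using d by (simp add: z d_def field_simps)
    then show ?thesis using d k_pos[of t] by (simp add: f_def z)
  qed
  have f_0: "f 0 = z" by (simp add: f_def K_def k_def bessel_k_def)
  have "prob_space.expectation M (\<lambda>\<omega>. exp (- l * X t \<omega>)) = enn2real (\<integral>\<^sup>+\<omega>. ennreal (exp (- l * X t \<omega>)) \<partial>M)"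
    using X_measurable[OF assms(9)] by (intro integral_eq_nn_integral) auto
  also have "\<dots> = exp (- x * z - integral {0..t} (\<lambda>u. f u * \<Delta> u))"
    using laplace_transform[OF assms(9) f f_nonneg] by (simp add: f_t f_0)
  \<comment> \<open>By its formula \<open>bessel_v\<close> at \<open>z\<close> is the integral of
    \<open>f * \<Delta>\<close> with the factor \<open>z\<close> pulled out.\<close>
  also have "integral {0..t} (\<lambda>u. f u * \<Delta> u) = bessel_psi \<Delta> \<theta> t l"
  proof -
    have "bessel_psi \<Delta> \<theta> t l = bessel_v \<Delta> \<theta> t z"
      by (simp add: bessel_psi_def z_def bessel_phi_def)
    also have "\<dots> = integral {0..t} (\<lambda>u. z * (\<Delta> u * k u / (1 - 2 * z * K u)))"
      unfolding bessel_v_def k_def K_def by (rule integral_mult_right[symmetric])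
    also have "\<dots> = integral {0..t} (\<lambda>u. f u * \<Delta> u)"
      by (rule arg_cong[where f = "integral {0..t}"]) (simp add: f_def fun_eq_iff)
    finally show ?thesis by simp
  qed
  finally show ?thesis by (simp add: z_def)
qed

end
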